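(* Let $\widetilde{M}$ be an oriented connected $3$-dimensional Riemannian manifold endowed with a concircular vector field $V$ with conformal scalar $\rho$, and let $\gamma:I\to\widetilde{M}$ be a Frenet curve of order $3$, parametrized by arc-length, with Frenet frame $(T^\gamma,N^\gamma,B^\gamma)$ and curvatures $\kappa,\tau$. Put $\phi=\frac{\tau}{\kappa}$. If $\gamma$ is a concircular curve with respect to $V$, i.e. $\langle V|_{\gamma(s)},N^\gamma(s)\rangle=\theta$ for all $s\in I$ with a constant $\theta\in\mathbb{R}$, and if $T^\gamma(\phi)$ is nowhere zero on $I$, then (with $\rho$ evaluated along $\gamma$) $$ \theta\,T^{\gamma}\!\left(\frac{\kappa(1+\phi^2)}{T^{\gamma}(\phi)}\right)+T^{\gamma}\!\left(\frac{\rho}{T^{\gamma}(\phi)}\right)+\theta\kappa\phi=0 . $$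
   Context: Concircular vector field: a nowhere-zero vector field $V$ on $\widetilde{M}$ for which there is a smooth function $\rho$ on $\widetilde{M}$ (the conformal scalar, or concircular factor) with $\widetilde{\nabla}_XV=\rho X$ for all vector fields $X$, where $\widetilde{\nabla}$ is the Levi-Civita connection. Frenet curve of order $3$: a curve $\gamma$ with tangent field $T^\gamma$ such that $\{T^\gamma,\widetilde{\nabla}_{T^\gamma}T^\gamma,\widetilde{\nabla}_{T^\gamma}^2T^\gamma\}$ is linearly independent at every parameter value. Its Frenet frame is the positively oriented orthonormal frame $(T^\gamma,N^\gamma,B^\gamma)$ along $\gamma$ with $\widetilde{\nabla}_{T^\gamma}T^\gamma=\kappa N^\gamma$, $\widetilde{\nabla}_{T^\gamma}N^\gamma=-\kappa T^\gamma+\tau B^\gamma$, $\widetilde{\nabla}_{T^\gamma}B^\gamma=-\tau N^\gamma$, where $\kappa>0$ and $\tau$ is nowhere zero. $T^\gamma(f)$ denotes the derivative $df/ds$ with respect to arc-length. *)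

theory Defs
  imports "HOL-Analysis.Analysis"
begin

(* Derivatives are taken within S. This is intended for sets S on which such derivatives are
   unique: open subsets of a Euclidean space (where it is the usual derivative), and relatively
   open subsets of a non-degenerate real interval (one-sided derivatives at its end points). *)
primrec higher_differentiable_on ::
  "nat \<Rightarrow> 'a::euclidean_space set \<Rightarrow> ('a \<Rightarrow> 'b::euclidean_space) \<Rightarrow> bool" where
  "higher_differentiable_on 0 S f \<longleftrightarrow> continuous_on S f"
| "higher_differentiable_on (Suc n) S f \<longleftrightarrow>
     (\<forall>x\<in>S. f differentiable (at x within S)) \<and>
     (\<forall>v. higher_differentiable_on n S (\<lambda>x. frechet_derivative f (at x within S) v))"

definition smooth_on :: "'a::euclidean_space set \<Rightarrow> ('a \<Rightarrow> 'b::euclidean_space) \<Rightarrow> bool" where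
  "smooth_on S f \<longleftrightarrow> (\<forall>n. higher_differentiable_on n S f)"

section \<open>Oriented smooth 3-manifolds\<close>

type_synonym 'a chart = "'a set \<times> ('a \<Rightarrow> real^3)"

abbreviation chart_dom :: "'a chart \<Rightarrow> 'a set" where
  "chart_dom c \<equiv> fst c"

abbreviation coord :: "'a chart \<Rightarrow> 'a \<Rightarrow> real^3" where
  "coord c \<equiv> snd c"

abbreviation coord_dom :: "'a chart \<Rightarrow> (real^3) set" where
  "coord_dom c \<equiv> coord c ` chart_dom c"

definition is_chart :: "'a topology \<Rightarrow> 'a chart \<Rightarrow> bool" where
  "is_chart X c \<longleftrightarrow> openin X (chart_dom c) \<and> open (coord_dom c) \<and>
     homeomorphic_map (subtopology X (chart_dom c)) (top_of_set (coord_dom c)) (coord c)"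

definition local_rep :: "'a chart \<Rightarrow> ('a \<Rightarrow> 'b) \<Rightarrow> real^3 \<Rightarrow> 'b" where
  "local_rep c f = f \<circ> inv_into (chart_dom c) (coord c)"

(* Differential at p of the change of coordinates from c to d; meaningful for p in both domains. *)
definition jacobian :: "'a chart \<Rightarrow> 'a chart \<Rightarrow> 'a \<Rightarrow> real^3 \<Rightarrow> real^3" where
  "jacobian c d p = frechet_derivative (local_rep c (coord d)) (at (coord c p))"

(* The orientation is the one for which all charts of the atlas are positively oriented. *)
definition oriented_atlas :: "'a topology \<Rightarrow> 'a chart set \<Rightarrow> bool" where
  "oriented_atlas X A \<longleftrightarrow>
     (\<forall>c\<in>A. is_chart X c) \<and> (\<Union>c\<in>A. chart_dom c) = topspace X \<and>
     (\<forall>c\<in>A. \<forall>d\<in>A.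
        smooth_on (coord c ` (chart_dom c \<inter> chart_dom d)) (local_rep c (coord d)) \<and>
        (\<forall>p\<in>chart_dom c \<inter> chart_dom d. det (matrix (jacobian c d p)) > 0))"

definition oriented_manifold :: "'a topology \<Rightarrow> 'a chart set \<Rightarrow> bool" where
  "oriented_manifold X A \<longleftrightarrow>
     Hausdorff_space X \<and> second_countable X \<and> oriented_atlas X A"

definition smooth_function :: "'a chart set \<Rightarrow> ('a \<Rightarrow> real) \<Rightarrow> bool" where
  "smooth_function A f \<longleftrightarrow> (\<forall>c\<in>A. smooth_on (coord_dom c) (local_rep c f))"

(* A tangent vector at p is a family of coordinate vectors, one for each chart of the atlas around p,
   related by the Jacobians of the coordinate changes. Accordingly, X c p is the coordinate vector
   of X(p) in the chart c; it is irrelevant if p lies outside the domain of c. *)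
type_synonym 'a field = "'a chart \<Rightarrow> 'a \<Rightarrow> real^3"

definition vector_field :: "'a chart set \<Rightarrow> 'a field \<Rightarrow> bool" where
  "vector_field A X \<longleftrightarrow>
     (\<forall>c\<in>A. smooth_on (coord_dom c) (local_rep c (X c))) \<and>
     (\<forall>c\<in>A. \<forall>d\<in>A. \<forall>p\<in>chart_dom c \<inter> chart_dom d. X d p = jacobian c d p (X c p))"

section \<open>Riemannian metric and Levi-Civita connection\<close>

(* g c p is the Gram matrix of the metric at p in the coordinates of the chart c. *)
type_synonym 'a metric_coeffs = "'a chart \<Rightarrow> 'a \<Rightarrow> real^3^3"

definition metric_inner :: "'a metric_coeffs \<Rightarrow> 'a chart \<Rightarrow> 'a \<Rightarrow> real^3 \<Rightarrow> real^3 \<Rightarrow> real" where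
  "metric_inner g c p v w = v \<bullet> (g c p *v w)"

definition riemannian_metric :: "'a chart set \<Rightarrow> 'a metric_coeffs \<Rightarrow> bool" where
  "riemannian_metric A g \<longleftrightarrow>
     (\<forall>c\<in>A. smooth_on (coord_dom c) (local_rep c (g c))) \<and>
     (\<forall>c\<in>A. \<forall>p\<in>chart_dom c.
        transpose (g c p) = g c p \<and> (\<forall>v. v \<noteq> 0 \<longrightarrow> metric_inner g c p v v > 0)) \<and>
     (\<forall>c\<in>A. \<forall>d\<in>A. \<forall>p\<in>chart_dom c \<inter> chart_dom d. \<forall>v w.
        metric_inner g c p v w = metric_inner g d p (jacobian c d p v) (jacobian c d p w))"

definition partial_deriv :: "'a chart \<Rightarrow> 3 \<Rightarrow> ('a \<Rightarrow> real) \<Rightarrow> 'a \<Rightarrow> real" where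
  "partial_deriv c i f p = frechet_derivative (local_rep c f) (at (coord c p)) (axis i 1)"

(* christoffel g c p k i j is the Christoffel symbol with upper index k and lower indices i, j,
   at p in the chart c. *)
definition christoffel :: "'a metric_coeffs \<Rightarrow> 'a chart \<Rightarrow> 'a \<Rightarrow> 3 \<Rightarrow> 3 \<Rightarrow> 3 \<Rightarrow> real" where
  "christoffel g c p k i j =
     (1/2) * (\<Sum>l\<in>UNIV. matrix_inv (g c p) $ k $ l *
        (partial_deriv c i (\<lambda>q. g c q $ j $ l) p
         + partial_deriv c j (\<lambda>q. g c q $ i $ l) p
         - partial_deriv c l (\<lambda>q. g c q $ i $ j) p))"

definition christoffel_term ::
  "'a metric_coeffs \<Rightarrow> 'a chart \<Rightarrow> 'a \<Rightarrow> real^3 \<Rightarrow> real^3 \<Rightarrow> real^3" where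
  "christoffel_term g c p u v =
     (\<chi> k. \<Sum>i\<in>UNIV. \<Sum>j\<in>UNIV. christoffel g c p k i j * u $ i * v $ j)"

(* Coordinate expression of the Levi-Civita derivative of Y in the direction of X. *)
definition cov_deriv :: "'a metric_coeffs \<Rightarrow> 'a field \<Rightarrow> 'a field \<Rightarrow> 'a field" where
  "cov_deriv g X Y = (\<lambda>c p.
     frechet_derivative (local_rep c (Y c)) (at (coord c p)) (X c p)
     + christoffel_term g c p (X c p) (Y c p))"

definition concircular_field ::
  "'a chart set \<Rightarrow> 'a metric_coeffs \<Rightarrow> 'a field \<Rightarrow> ('a \<Rightarrow> real) \<Rightarrow> bool" where
  "concircular_field A g V \<rho> \<longleftrightarrow>
     vector_field A V \<and> (\<forall>c\<in>A. \<forall>p\<in>chart_dom c. V c p \<noteq> 0) \<and>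
     smooth_function A \<rho> \<and>
     (\<forall>X. vector_field A X \<longrightarrow>
        (\<forall>c\<in>A. \<forall>p\<in>chart_dom c. cov_deriv g X V c p = \<rho> p *\<^sub>R X c p))"

section \<open>Curves\<close>

(* I is a real interval, possibly containing end points, where derivatives are one-sided. *)
definition smooth_curve ::
  "'a topology \<Rightarrow> 'a chart set \<Rightarrow> real set \<Rightarrow> (real \<Rightarrow> 'a) \<Rightarrow> bool" where
  "smooth_curve X A I \<gamma> \<longleftrightarrow>
     is_interval I \<and> (\<exists>a\<in>I. \<exists>b\<in>I. a < b) \<and>
     continuous_map (top_of_set I) X \<gamma> \<and>
     (\<forall>c\<in>A. smooth_on {s\<in>I. \<gamma> s \<in> chart_dom c} (\<lambda>s. coord c (\<gamma> s)))"

definition curve_deriv :: "real set \<Rightarrow> (real \<Rightarrow> 'b::real_normed_vector) \<Rightarrow> real \<Rightarrow> 'b" where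
  "curve_deriv I f s = vector_derivative f (at s within I)"

(* Vector fields along a curve: W c s is the coordinate vector of W(s) in a chart c around the
   point of parameter s. *)
type_synonym 'a curve_field = "'a chart \<Rightarrow> real \<Rightarrow> real^3"

definition field_along ::
  "'a chart set \<Rightarrow> real set \<Rightarrow> (real \<Rightarrow> 'a) \<Rightarrow> 'a curve_field \<Rightarrow> bool" where
  "field_along A I \<gamma> W \<longleftrightarrow>
     (\<forall>c\<in>A. smooth_on {s\<in>I. \<gamma> s \<in> chart_dom c} (W c)) \<and>
     (\<forall>c\<in>A. \<forall>d\<in>A. \<forall>s\<in>I. \<gamma> s \<in> chart_dom c \<inter> chart_dom d \<longrightarrow>
        W d s = jacobian c d (\<gamma> s) (W c s))"

definition velocity :: "real set \<Rightarrow> (real \<Rightarrow> 'a) \<Rightarrow> 'a curve_field" where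
  "velocity I \<gamma> = (\<lambda>c. curve_deriv I (\<lambda>t. coord c (\<gamma> t)))"

(* Levi-Civita derivative of W along the curve, in the direction of its velocity. *)
definition cov_deriv_along ::
  "'a metric_coeffs \<Rightarrow> real set \<Rightarrow> (real \<Rightarrow> 'a) \<Rightarrow> 'a curve_field \<Rightarrow> 'a curve_field" where
  "cov_deriv_along g I \<gamma> W = (\<lambda>c s.
     curve_deriv I (W c) s + christoffel_term g c (\<gamma> s) (velocity I \<gamma> c s) (W c s))"

definition arc_length_parametrized ::
  "'a chart set \<Rightarrow> 'a metric_coeffs \<Rightarrow> real set \<Rightarrow> (real \<Rightarrow> 'a) \<Rightarrow> bool" where
  "arc_length_parametrized A g I \<gamma> \<longleftrightarrow>
     (\<forall>c\<in>A. \<forall>s\<in>I. \<gamma> s \<in> chart_dom c \<longrightarrow>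
        metric_inner g c (\<gamma> s) (velocity I \<gamma> c s) (velocity I \<gamma> c s) = 1)"

definition frenet_curve3 ::
  "'a topology \<Rightarrow> 'a chart set \<Rightarrow> 'a metric_coeffs \<Rightarrow> real set \<Rightarrow> (real \<Rightarrow> 'a) \<Rightarrow> bool" where
  "frenet_curve3 X A g I \<gamma> \<longleftrightarrow>
     smooth_curve X A I \<gamma> \<and>
     (\<forall>c\<in>A. \<forall>s\<in>I. \<gamma> s \<in> chart_dom c \<longrightarrow>
        (let D = cov_deriv_along g I \<gamma>; T = velocity I \<gamma>
         in distinct [T c s, D T c s, D (D T) c s] \<and>
            independent {T c s, D T c s, D (D T) c s}))"

definition frenet_frame ::
  "'a chart set \<Rightarrow> 'a metric_coeffs \<Rightarrow> real set \<Rightarrow> (real \<Rightarrow> 'a) \<Rightarrow>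
   'a curve_field \<Rightarrow> 'a curve_field \<Rightarrow> 'a curve_field \<Rightarrow> (real \<Rightarrow> real) \<Rightarrow> (real \<Rightarrow> real) \<Rightarrow> bool" where
  "frenet_frame A g I \<gamma> T N B \<kappa> \<tau> \<longleftrightarrow>
     T = velocity I \<gamma> \<and> field_along A I \<gamma> N \<and> field_along A I \<gamma> B \<and>
     (\<forall>s\<in>I. \<kappa> s > 0 \<and> \<tau> s \<noteq> 0) \<and>
     (\<forall>c\<in>A. \<forall>s\<in>I. \<gamma> s \<in> chart_dom c \<longrightarrow>
        (let ip = metric_inner g c (\<gamma> s); D = cov_deriv_along g I \<gamma>
         in ip (T c s) (T c s) = 1 \<and> ip (N c s) (N c s) = 1 \<and> ip (B c s) (B c s) = 1 \<and>
            ip (T c s) (N c s) = 0 \<and> ip (T c s) (B c s) = 0 \<and> ip (N c s) (B c s) = 0 \<and>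
            det (vector [T c s, N c s, B c s] :: real^3^3) > 0 \<and>
            D T c s = \<kappa> s *\<^sub>R N c s \<and>
            D N c s = - \<kappa> s *\<^sub>R T c s + \<tau> s *\<^sub>R B c s \<and>
            D B c s = - \<tau> s *\<^sub>R N c s))"

definition concircular_curve ::
  "'a chart set \<Rightarrow> 'a metric_coeffs \<Rightarrow> 'a field \<Rightarrow> real set \<Rightarrow> (real \<Rightarrow> 'a) \<Rightarrow> 'a curve_field \<Rightarrow>
   real \<Rightarrow> bool" where
  "concircular_curve A g V I \<gamma> N \<theta> \<longleftrightarrow>
     (\<forall>c\<in>A. \<forall>s\<in>I. \<gamma> s \<in> chart_dom c \<longrightarrow>
        metric_inner g c (\<gamma> s) (V c (\<gamma> s)) (N c s) = \<theta>)"

end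

theory Submission
  imports Defs
begin

text \<open>
  Write \<open>v\<close>, \<open>\<theta>\<close>, \<open>b\<close> for the components of \<open>V\<close> along \<open>\<gamma>\<close> in the Frenet frame. Since the derivative of
  \<open>V\<close> in the direction of \<open>T\<close> is \<open>\<rho> T\<close>, the Frenet equations and the compatibility of the connection
  with the metric give, by differentiating the three inner products,
  \<open>v' = \<rho> + \<kappa> \<theta>\<close>, \<open>0 = - \<kappa> v + \<tau> b\<close> and \<open>b' = - \<tau> \<theta>\<close>.
  The second equation says \<open>v = \<phi> b\<close>. Its derivative, combined with the other two, determines
  \<open>b = (\<rho> + \<theta> \<kappa> (1 + \<phi>\<^sup>2)) / \<phi>'\<close>, and substituting this into \<open>b' = - \<theta> \<kappa> \<phi>\<close> is the theorem
  (\<open>concircular_curve_ode\<close>).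

  Three points need work. First, the defining property of \<open>V\<close> speaks of global vector fields, while
  it is applied to the velocity of a curve; \<open>concircular_field_derivative\<close> passes to single tangent
  vectors by extending them with a bump function. Second, the product rule along the curve
  (\<open>metric_inner_along_has_derivative\<close>) is derived from the coordinate formula for the Christoffel
  symbols, contracted with the metric so that the inverse matrix disappears. Third, the conclusion
  contains derivatives of two separate quotients by \<open>\<phi>'\<close>, hence \<open>\<kappa>\<close> and \<open>\<tau>\<close> must be shown to be twice
  differentiable: they are inner products of smooth fields with covariant derivatives of smooth fields
  (\<open>metric_inner_cov_deriv_differentiable\<close>). For these smoothness arguments the iterated derivatives
  are shown to be closed under sums, products and composition.
\<close>

section \<open>Calculus of iterated derivatives\<close>

text \<open>
  Derivatives within \<open>S\<close> are unique as soon as every point of \<open>S\<close> can be approached inside \<open>S\<close>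
  along each coordinate line. Open sets have this property, and so do the parameter sets of curves,
  including at end points of the interval.
\<close>

definition unique_diff :: "'a::euclidean_space set \<Rightarrow> bool" where
  "unique_diff S \<longleftrightarrow>
     (\<forall>x\<in>S. \<forall>i\<in>Basis. \<forall>e>0. \<exists>d. 0 < \<bar>d\<bar> \<and> \<bar>d\<bar> < e \<and> x + d *\<^sub>R i \<in> S)"

lemma frechet_derivative_within_eq:
  assumes "unique_diff S" "x \<in> S" "(f has_derivative f') (at x within S)"
  shows "frechet_derivative f (at x within S) = f'"
proof -
  have "(f has_derivative frechet_derivative f (at x within S)) (at x within S)"
    using assms(3) frechet_derivative_works differentiableI by blast
  then show ?thesis
    using frechet_derivative_unique_within[OF _ assms(3)] assms(1,2)
    unfolding unique_diff_def by blast
qed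

lemma unique_diff_open: 
  assumes "open S" shows "unique_diff S"
  unfolding unique_diff_def
proof (intro ballI allI impI)
  fix x i :: 'a and e :: real
  assume x: "x \<in> S" and i: "i \<in> Basis" and e: "0 < e"
  obtain r where r: "r > 0" "ball x r \<subseteq> S" using assms x openE by blast
  define d where "d = min e r / 2"
  have "d > 0" "d < e" "d < r" using e r by (auto simp: d_def min_def)
  moreover have "x + d *\<^sub>R i \<in> ball x r" using i \<open>d > 0\<close> \<open>d < r\<close> by (simp add: dist_norm)
  ultimately show "\<exists>d. 0 < \<bar>d\<bar> \<and> \<bar>d\<bar> < e \<and> x + d *\<^sub>R i \<in> S"
    using r(2) by (intro exI[of _ d]) auto
qed

lemma unique_diff_interval_Int_open:
  fixes I U :: "real set"
  assumes I: "is_interval I" and ab: "a \<in> I" "b \<in> I" "a < b" and U: "open U"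
  shows "unique_diff (I \<inter> U)"
  unfolding unique_diff_def
proof (intro ballI allI impI)
  fix x i e :: real
  assume x: "x \<in> I \<inter> U" and i: "i \<in> Basis" and e: "0 < e"
  obtain r where r: "r > 0" "ball x r \<subseteq> U" using U x openE by blast
  define m where "m = min e r / 2"
  have m: "m > 0" "m < e" "m < r" using e r by (auto simp: m_def min_def)
  obtain y where y: "y \<in> I" "y \<noteq> x" using ab by (metis less_irrefl)
  define d where "d = (if x < y then min m (y - x) else - min m (x - y))"
  have d: "0 < \<bar>d\<bar>" "\<bar>d\<bar> \<le> m" and le: "min x y \<le> x + d" "x + d \<le> max x y"
    using y m by (auto simp: d_def min_def max_def)
  have "x + d \<in> I"
  proof (cases "x < y")
    case True
    then show ?thesis using mem_is_interval_1_I[OF I, of x y "x + d"] x y le by auto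
  next
    case False
    then show ?thesis using mem_is_interval_1_I[OF I, of y x "x + d"] x y le by auto
  qed
  moreover have "x + d \<in> U" using r(2) d m by (auto simp: dist_norm subset_iff)
  ultimately show "\<exists>d. 0 < \<bar>d\<bar> \<and> \<bar>d\<bar> < e \<and> x + d *\<^sub>R i \<in> I \<inter> U"
    using d m i by (intro exI[of _ d]) auto
qed

lemma frechet_derivative_within_cong:
  assumes "\<And>y. y \<in> S \<Longrightarrow> f y = g y" "x \<in> S"
  shows "frechet_derivative f (at x within S) = frechet_derivative g (at x within S)"
proof -
  have "(f has_derivative D) (at x within S) \<longleftrightarrow> (g has_derivative D) (at x within S)" for D
    using has_derivative_transform[OF assms(2), of f g] has_derivative_transform[OF assms(2), of g f]
      assms(1) by auto
  then show ?thesis unfolding frechet_derivative_def by presburger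
qed

lemma higher_differentiable_on_cong:
  assumes "\<And>x. x \<in> S \<Longrightarrow> f x = g x"
  shows "higher_differentiable_on n S f \<longleftrightarrow> higher_differentiable_on n S g"
  using assms
proof (induction n arbitrary: f g)
  case 0
  then show ?case by (simp cong: continuous_on_cong)
next
  case (Suc n)
  have "f differentiable at x within S \<longleftrightarrow> g differentiable at x within S" if "x \<in> S" for x
    using has_derivative_transform[OF that, of f g] has_derivative_transform[OF that, of g f]
      Suc.prems unfolding differentiable_def by (metis (full_types))
  moreover have "higher_differentiable_on n S (\<lambda>x. frechet_derivative f (at x within S) v) \<longleftrightarrow>
      higher_differentiable_on n S (\<lambda>x. frechet_derivative g (at x within S) v)" for v
    by (rule Suc.IH) (simp add: frechet_derivative_within_cong[OF Suc.prems])
  ultimately show ?case by simp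
qed

lemma higher_differentiable_on_SucI:
  assumes "unique_diff S"
    and "\<And>x. x \<in> S \<Longrightarrow> (f has_derivative f' x) (at x within S)"
    and "\<And>v. higher_differentiable_on n S (\<lambda>x. f' x v)"
  shows "higher_differentiable_on (Suc n) S f"
proof -
  have "higher_differentiable_on n S (\<lambda>x. frechet_derivative f (at x within S) v)" for v
    using assms(3)[of v]
    by (subst higher_differentiable_on_cong[where g = "\<lambda>x. f' x v"])
       (simp_all add: frechet_derivative_within_eq[OF assms(1) _ assms(2)])
  moreover have "f differentiable at x within S" if "x \<in> S" for x
    using assms(2)[OF that] by (rule differentiableI)
  ultimately show ?thesis by simp
qed

lemma higher_differentiable_on_SucD:
  assumes "higher_differentiable_on (Suc n) S f"
  shows "x \<in> S \<Longrightarrow> (f has_derivative frechet_derivative f (at x within S)) (at x within S)"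
    and "higher_differentiable_on n S (\<lambda>x. frechet_derivative f (at x within S) v)"
  using assms by (auto simp: frechet_derivative_works)

lemma higher_differentiable_on_Suc_imp:
  "higher_differentiable_on (Suc n) S f \<Longrightarrow> higher_differentiable_on n S f"
proof (induction n arbitrary: f)
  case 0
  then show ?case
    by (auto simp: continuous_on_eq_continuous_within differentiable_imp_continuous_within)
next
  case (Suc n)
  then show ?case by (metis higher_differentiable_on.simps(2))
qed

text \<open>
  A filter \<open>at x within S\<close> sees only a neighbourhood of \<open>x\<close>, so the derivatives of all orders
  within \<open>S\<close> and within a neighbourhood of \<open>x\<close> in \<open>S\<close> coincide.
\<close>

lemma higher_differentiable_on_locally:
  assumes "\<And>x. x \<in> S \<Longrightarrow> \<exists>U. open U \<and> x \<in> U \<and> higher_differentiable_on n (S \<inter> U) f"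
  shows "higher_differentiable_on n S f"
  using assms
proof (induction n arbitrary: f)
  case 0
  have "continuous (at x within S) f" if x: "x \<in> S" for x
  proof -
    obtain U where U: "open U" "x \<in> U" "continuous_on (S \<inter> U) f" using 0 x by auto
    then have "continuous (at x within (S \<inter> U)) f"
      using x by (simp add: continuous_on_eq_continuous_within)
    moreover have "at x within (S \<inter> U) = at x within S"
      by (rule at_within_nhd[of _ U]) (use U in auto)
    ultimately show ?thesis by simp
  qed
  then show ?case by (simp add: continuous_on_eq_continuous_within)
next
  case (Suc n)
  have eq: "at x within (S \<inter> U) = at x within S" if "open U" "x \<in> U" for x U
    by (rule at_within_nhd[of _ U]) (use that in auto)
  have "f differentiable at x within S" if x: "x \<in> S" for x
    using Suc.prems[OF x] eq x by auto
  moreover have "higher_differentiable_on n S (\<lambda>x. frechet_derivative f (at x within S) v)" for v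
  proof (rule Suc.IH)
    fix x assume "x \<in> S"
    then obtain U where U: "open U" "x \<in> U" "higher_differentiable_on (Suc n) (S \<inter> U) f"
      using Suc.prems by blast
    have "higher_differentiable_on n (S \<inter> U) (\<lambda>x. frechet_derivative f (at x within S) v)"
      using U higher_differentiable_on_SucD(2)[OF U(3), of v]
      by (subst higher_differentiable_on_cong
            [where g = "\<lambda>x. frechet_derivative f (at x within (S \<inter> U)) v"]) (auto simp: eq)
    then show "\<exists>U. open U \<and> x \<in> U \<and>
        higher_differentiable_on n (S \<inter> U) (\<lambda>x. frechet_derivative f (at x within S) v)"
      using U by blast
  qed
  ultimately show ?case by simp
qed

lemma higher_differentiable_on_const:
  assumes "unique_diff S" shows "higher_differentiable_on n S (\<lambda>x. k)"
proof (induction n arbitrary: k)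
  case (Suc n)
  show ?case by (rule higher_differentiable_on_SucI[OF assms, of _ "\<lambda>x v. 0"]) (auto intro: Suc)
qed simp

lemma higher_differentiable_on_ident:
  assumes "unique_diff S" shows "higher_differentiable_on n S (\<lambda>x. x)"
proof (cases n)
  case (Suc m)
  show ?thesis unfolding Suc
    by (rule higher_differentiable_on_SucI[OF assms, of _ "\<lambda>x v. v"])
       (auto intro: higher_differentiable_on_const[OF assms])
qed simp

lemma higher_differentiable_on_linear:
  assumes "bounded_linear L" "unique_diff S" "higher_differentiable_on n S f"
  shows "higher_differentiable_on n S (\<lambda>x. L (f x))"
  using assms(3)
proof (induction n arbitrary: f)
  case 0
  then show ?case using assms(1) by (simp add: bounded_linear.continuous_on)
next
  case (Suc n)
  note D = higher_differentiable_on_SucD[OF Suc.prems]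
  show ?case
    by (rule higher_differentiable_on_SucI[OF assms(2),
          where f' = "\<lambda>x v. L (frechet_derivative f (at x within S) v)"])
       (intro bounded_linear.has_derivative[OF assms(1)] D Suc.IH | assumption)+
qed

lemma higher_differentiable_on_add:
  assumes "unique_diff S" "higher_differentiable_on n S f" "higher_differentiable_on n S g"
  shows "higher_differentiable_on n S (\<lambda>x. f x + g x)"
  using assms(2,3)
proof (induction n arbitrary: f g)
  case 0
  then show ?case by (simp add: continuous_on_add)
next
  case (Suc n)
  note D = higher_differentiable_on_SucD[OF Suc.prems(1)] higher_differentiable_on_SucD[OF Suc.prems(2)]
  show ?case
    by (rule higher_differentiable_on_SucI[OF assms(1), where f' = "\<lambda>x v.
          frechet_derivative f (at x within S) v + frechet_derivative g (at x within S) v"])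
       (intro has_derivative_add D Suc.IH | assumption)+
qed

lemma higher_differentiable_on_sum:
  assumes "unique_diff S" "\<And>i. i \<in> K \<Longrightarrow> higher_differentiable_on n S (f i)"
  shows "higher_differentiable_on n S (\<lambda>x. \<Sum>i\<in>K. f i x)"
  using assms(2)
  by (induction K rule: infinite_finite_induct)
     (auto intro: higher_differentiable_on_const higher_differentiable_on_add assms(1))

lemma higher_differentiable_on_bilinear:
  fixes bl :: "'b::euclidean_space \<Rightarrow> 'c::euclidean_space \<Rightarrow> 'd::euclidean_space"
  assumes "bounded_bilinear bl" "unique_diff S"
    "higher_differentiable_on n S f" "higher_differentiable_on n S g"
  shows "higher_differentiable_on n S (\<lambda>x. bl (f x) (g x))"
  using assms(3,4)
proof (induction n arbitrary: f g)
  case 0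
  then show ?case using assms(1) by (simp add: bounded_bilinear.continuous_on)
next
  case (Suc n)
  note D = higher_differentiable_on_SucD[OF Suc.prems(1)] higher_differentiable_on_SucD[OF Suc.prems(2)]
  show ?case
  proof (rule higher_differentiable_on_SucI[OF assms(2)])
    fix x assume x: "x \<in> S"
    show "((\<lambda>x. bl (f x) (g x)) has_derivative (\<lambda>v. bl (f x) (frechet_derivative g (at x within S) v)
        + bl (frechet_derivative f (at x within S) v) (g x))) (at x within S)"
      by (rule bounded_bilinear.FDERIV[OF assms(1) D(1)[OF x] D(3)[OF x]])
  qed (intro higher_differentiable_on_add[OF assms(2)] Suc.IH D
        Suc.prems[THEN higher_differentiable_on_Suc_imp])
qed

lemmas higher_differentiable_on_mult = higher_differentiable_on_bilinear[OF bounded_bilinear_mult]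

text \<open>
  The chain rule writes a derivative of \<open>f \<circ> h\<close> as a finite sum of products of directional
  derivatives of \<open>h\<close> with functions \<open>f' \<circ> h\<close>, where \<open>f'\<close> is a partial derivative of \<open>f\<close>. The latter
  are again compositions with \<open>h\<close>, of one order less: this is what drives the induction.
\<close>

lemma higher_differentiable_on_compose:
  assumes S: "unique_diff S" and sub: "h ` S \<subseteq> R"
    and f: "higher_differentiable_on n R f" and h: "higher_differentiable_on n S h"
  shows "higher_differentiable_on n S (\<lambda>x. f (h x))"
  using f h
proof (induction n arbitrary: f)
  case 0
  then show ?case using continuous_on_compose2 sub by auto
next
  case (Suc n)
  note Df = higher_differentiable_on_SucD[OF Suc.prems(1)]
  note Dh = higher_differentiable_on_SucD[OF Suc.prems(2)]
  let ?f' = "\<lambda>x. frechet_derivative f (at x within R)"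
  let ?h' = "\<lambda>x. frechet_derivative h (at x within S)"
  show ?case
  proof (rule higher_differentiable_on_SucI[OF S])
    fix x assume x: "x \<in> S"
    then have "h x \<in> R" using sub by auto
    note f' = Df(1)[OF this]
    have chain: "((\<lambda>x. f (h x)) has_derivative (\<lambda>v. ?f' (h x) (?h' x v))) (at x within S)"
      by (rule has_derivative_in_compose[OF Dh(1)[OF x] has_derivative_subset[OF f' sub]])
    have exp: "?f' (h x) w = (\<Sum>b\<in>Basis. (w \<bullet> b) *\<^sub>R ?f' (h x) b)" for w
    proof -
      interpret F: bounded_linear "?f' (h x)" using f' has_derivative_bounded_linear by blast
      have "?f' (h x) (\<Sum>b\<in>Basis. (w \<bullet> b) *\<^sub>R b) = (\<Sum>b\<in>Basis. (w \<bullet> b) *\<^sub>R ?f' (h x) b)"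
        unfolding F.sum F.scaleR ..
      then show ?thesis by (simp only: euclidean_representation)
    qed
    show "((\<lambda>x. f (h x)) has_derivative
        (\<lambda>v. \<Sum>b\<in>Basis. (?h' x v \<bullet> b) *\<^sub>R ?f' (h x) b)) (at x within S)"
      by (rule has_derivative_eq_rhs[OF chain]) (rule ext, rule exp)
  next
    fix v
    have "higher_differentiable_on n S (\<lambda>x. ?f' (h x) b)" for b
      using Suc.IH[OF Df(2) higher_differentiable_on_Suc_imp[OF Suc.prems(2)]] .
    moreover have "higher_differentiable_on n S (\<lambda>x. ?h' x v \<bullet> b)" for b
      by (rule higher_differentiable_on_linear[OF bounded_linear_inner_left S Dh(2)])
    ultimately show "higher_differentiable_on n S (\<lambda>x. \<Sum>b\<in>Basis. (?h' x v \<bullet> b) *\<^sub>R ?f' (h x) b)"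
      by (intro higher_differentiable_on_sum[OF S]
          higher_differentiable_on_bilinear[OF bounded_bilinear_scaleR S])
  qed
qed

section \<open>A smooth bump function\<close>

text \<open>
  For \<open>k = 0\<close> this is Cauchy's function \<open>exp (- 1 / t)\<close>, extended by \<open>0\<close> to \<open>t \<le> 0\<close>. The extra powers of
  \<open>1 / t\<close> make the family closed, up to linear combinations, under differentiation.
\<close>

definition flat :: "nat \<Rightarrow> real \<Rightarrow> real" where
  "flat k t = (if t > 0 then inverse t ^ k * exp (- inverse t) else 0)"

lemma flat_tendsto_0: "(flat k \<longlongrightarrow> 0) (at 0)"
proof (subst filterlim_at_split, intro conjI)
  show "(flat k \<longlongrightarrow> 0) (at_left 0)"
    by (rule tendsto_eventually) (auto simp: flat_def eventually_at_filter)
  have "((\<lambda>t. inverse t ^ k / exp (inverse t)) \<longlongrightarrow> 0) (at_right (0::real))"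
    using filterlim_compose[OF tendsto_power_div_exp_0 filterlim_inverse_at_top_right] .
  then show "(flat k \<longlongrightarrow> 0) (at_right 0)"
    by (rule Lim_transform_eventually)
       (auto simp: flat_def eventually_at_filter exp_minus field_simps)
qed

text \<open>
  At \<open>0\<close> the difference quotient of \<open>flat k\<close> is \<open>flat (Suc k)\<close>, which tends to \<open>0\<close> because the
  exponential beats every power.
\<close>

lemma flat_has_derivative: "(flat k has_real_derivative - real k * flat (Suc k) t + flat (Suc (Suc k)) t) (at t)"
proof -
  consider "t < 0" | "t = 0" | "t > 0" by linarith
  then show ?thesis
  proof cases
    case 1
    have "(flat k has_real_derivative 0) (at t)"
      by (rule has_field_derivative_transform_within_open[of "\<lambda>_. 0" _ _ "{..<0}"])
         (use 1 in \<open>auto simp: flat_def\<close>)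
    then show ?thesis using 1 by (simp add: flat_def)
  next
    case 2
    have "((\<lambda>y. (flat k y - flat k 0) / (y - 0)) \<longlongrightarrow> 0) (at 0)"
      by (rule Lim_transform_eventually[OF flat_tendsto_0[of "Suc k"]])
         (auto simp: flat_def eventually_at_filter divide_inverse)
    then show ?thesis using 2 by (simp add: has_field_derivative_iff flat_def)
  next
    case 3
    have inv: "(inverse has_real_derivative - (inverse t ^ 2)) (at t)"
      using DERIV_inverse[of t] 3 by (simp add: numeral_2_eq_2)
    have "((\<lambda>t. inverse t ^ k) has_real_derivative - real k * inverse t ^ Suc k) (at t)"
      using DERIV_power[OF inv, of k] by (cases k) (simp_all add: power2_eq_square algebra_simps)
    moreover have "((\<lambda>t. exp (- inverse t)) has_real_derivative exp (- inverse t) * inverse t ^ 2) (at t)"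
      using DERIV_fun_exp[OF DERIV_minus[OF inv]] by simp
    ultimately have "((\<lambda>t. inverse t ^ k * exp (- inverse t)) has_real_derivative
        - real k * (inverse t ^ Suc k * exp (- inverse t)) + inverse t ^ Suc (Suc k) * exp (- inverse t)) (at t)"
      using DERIV_mult by (fastforce simp: power2_eq_square algebra_simps)
    then have "(flat k has_real_derivative
        - real k * (inverse t ^ Suc k * exp (- inverse t)) + inverse t ^ Suc (Suc k) * exp (- inverse t)) (at t)"
      by (rule has_field_derivative_transform_within_open[of _ _ _ "{0<..}"])
         (use 3 in \<open>auto simp: flat_def\<close>)
    then show ?thesis using 3 by (simp add: flat_def)
  qed
qed

lemma higher_differentiable_on_flat: "higher_differentiable_on n UNIV (flat k)"
proof (induction n arbitrary: k)
  case 0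
  have "continuous_on UNIV (flat k)"
    by (rule continuous_at_imp_continuous_on) (use flat_has_derivative DERIV_isCont in blast)
  then show ?case by simp
next
  case (Suc n)
  have U: "unique_diff (UNIV :: real set)" by (simp add: unique_diff_open)
  show ?case
  proof (rule higher_differentiable_on_SucI[OF U])
    show "(flat k has_derivative (\<lambda>v. (- real k * flat (Suc k) t + flat (Suc (Suc k)) t) * v)) (at t)" for t
      by (rule flat_has_derivative[unfolded has_field_derivative_def])
    show "higher_differentiable_on n UNIV (\<lambda>t. (- real k * flat (Suc k) t + flat (Suc (Suc k)) t) * v)" for v
      by (intro higher_differentiable_on_mult higher_differentiable_on_add
          higher_differentiable_on_const Suc.IH U)
  qed
qed

lemma smooth_bump_exists:
  fixes a :: "'a::euclidean_space"
  assumes "r > 0"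
  obtains \<beta> :: "'a \<Rightarrow> real"
  where "smooth_on UNIV \<beta>" "\<beta> a = 1" "\<forall>x. x \<notin> cball a r \<longrightarrow> \<beta> x = 0"
proof
  have U: "unique_diff (UNIV :: 'a set)" "unique_diff (UNIV :: real set)"
    by (simp_all add: unique_diff_open)
  define \<beta> where "\<beta> x = inverse (flat 0 (r\<^sup>2)) * flat 0 (r\<^sup>2 + (- 1) * ((x + - a) \<bullet> (x + - a)))" for x
  have "higher_differentiable_on n UNIV \<beta>" for n
  proof -
    have d: "higher_differentiable_on n UNIV (\<lambda>x. x + - a)"
      by (rule higher_differentiable_on_add[OF U(1) higher_differentiable_on_ident[OF U(1)]
            higher_differentiable_on_const[OF U(1)]])
    have "higher_differentiable_on n UNIV (\<lambda>x. r\<^sup>2 + (- 1) * ((x + - a) \<bullet> (x + - a)))"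
      by (intro higher_differentiable_on_add higher_differentiable_on_mult
            higher_differentiable_on_const higher_differentiable_on_bilinear[OF bounded_bilinear_inner] U d)
    from higher_differentiable_on_compose[OF U(1) subset_UNIV higher_differentiable_on_flat this]
    show ?thesis unfolding \<beta>_def
      by (rule higher_differentiable_on_mult[OF U(1) higher_differentiable_on_const[OF U(1)]])
  qed
  then show "smooth_on UNIV \<beta>" by (simp add: smooth_on_def)
  show "\<beta> a = 1" using assms by (simp add: \<beta>_def flat_def)
  show "\<forall>x. x \<notin> cball a r \<longrightarrow> \<beta> x = 0"
  proof (intro allI impI)
    fix x assume "x \<notin> cball a r"
    then have "r < norm (x - a)" by (simp add: dist_norm norm_minus_commute)
    then have "r\<^sup>2 < (x - a) \<bullet> (x - a)"
      using assms by (simp add: power2_norm_eq_inner[symmetric] power_strict_mono)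
    then show "\<beta> x = 0" by (simp add: \<beta>_def flat_def)
  qed
qed

section \<open>Charts, and vector fields through a given tangent vector\<close>

lemma inj_on_chart:
  assumes "is_chart M c" shows "inj_on (coord c) (chart_dom c)"
proof -
  have "topspace (subtopology M (chart_dom c)) = chart_dom c"
    using assms openin_subset unfolding is_chart_def by fastforce
  then show ?thesis
    using assms homeomorphic_imp_injective_map unfolding is_chart_def by metis
qed

lemma local_rep_coord:
  assumes "is_chart M c" "p \<in> chart_dom c" shows "local_rep c f (coord c p) = f p"
  using inv_into_f_f[OF inj_on_chart[OF assms(1)] assms(2)] by (simp add: local_rep_def)

lemma open_chart_image:
  assumes "is_chart M c" "openin M W" shows "open (coord c ` (chart_dom c \<inter> W))"
proof -
  have "openin (subtopology M (chart_dom c)) (chart_dom c \<inter> W)"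
    using assms(2) openin_subtopology_Int2 by blast
  then have "openin (top_of_set (coord_dom c)) (coord c ` (chart_dom c \<inter> W))"
    using assms(1) homeomorphic_imp_open_map unfolding is_chart_def open_map_def by blast
  then show ?thesis using assms(1) openin_open_eq unfolding is_chart_def by blast
qed

lemma compactin_chart_preimage:
  assumes "is_chart M c" "compact K" "K \<subseteq> coord_dom c"
  shows "compactin M {p \<in> chart_dom c. coord c p \<in> K}"
proof -
  have h: "homeomorphic_map (subtopology M (chart_dom c)) (top_of_set (coord_dom c)) (coord c)"
    using assms(1) by (simp add: is_chart_def)
  have top: "topspace (subtopology M (chart_dom c)) = chart_dom c"
    using assms openin_subset unfolding is_chart_def by fastforce
  have "coord c ` {p \<in> chart_dom c. coord c p \<in> K} = K" using assms(3) by auto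
  then have "compactin (subtopology M (chart_dom c)) {p \<in> chart_dom c. coord c p \<in> K}"
    using homeomorphic_map_compactness_eq[OF h, of "{p \<in> chart_dom c. coord c p \<in> K}"] assms(2,3)
    unfolding top by (simp add: compactin_subtopology)
  then show ?thesis by (simp add: compactin_subtopology)
qed

lemma transition_has_derivative:
  assumes "oriented_atlas M A" "c \<in> A" "d \<in> A" "p \<in> chart_dom c \<inter> chart_dom d"
  shows "(local_rep c (coord d) has_derivative jacobian c d p) (at (coord c p))"
proof -
  let ?S = "coord c ` (chart_dom c \<inter> chart_dom d)"
  have ch: "is_chart M c" "is_chart M d" and sm: "smooth_on ?S (local_rep c (coord d))"
    using assms unfolding oriented_atlas_def by blast+
  have "open ?S" by (rule open_chart_image[OF ch(1)]) (use ch(2) in \<open>simp add: is_chart_def\<close>)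
  moreover have "coord c p \<in> ?S" using assms(4) by blast
  moreover have "higher_differentiable_on (Suc 0) ?S (local_rep c (coord d))"
    using sm unfolding smooth_on_def by blast
  then have "\<forall>x\<in>?S. local_rep c (coord d) differentiable (at x within ?S)" by simp
  ultimately have "local_rep c (coord d) differentiable (at (coord c p))"
    by (metis at_within_open)
  then show ?thesis unfolding jacobian_def by (simp add: frechet_derivative_works)
qed

lemma jacobian_compose:
  assumes A: "oriented_atlas M A" "b \<in> A" "c \<in> A" "d \<in> A"
    and p: "p \<in> chart_dom b \<inter> chart_dom c \<inter> chart_dom d"
  shows "jacobian c d p (jacobian b c p u) = jacobian b d p u"
proof -
  have ch: "is_chart M b" "is_chart M c" "is_chart M d"
    using A unfolding oriented_atlas_def by blast+
  let ?S = "coord b ` (chart_dom b \<inter> (chart_dom c \<inter> chart_dom d))"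
  have S: "open ?S" "coord b p \<in> ?S"
    using open_chart_image[OF ch(1) openin_Int, of "chart_dom c" "chart_dom d"] ch(2,3) p
    by (simp_all add: is_chart_def)
  have "local_rep b (coord c) (coord b p) = coord c p" by (rule local_rep_coord[OF ch(1)]) (use p in blast)
  then have "(local_rep c (coord d) has_derivative jacobian c d p)
      (at (local_rep b (coord c) (coord b p)))"
    using transition_has_derivative[OF A(1,3,4), of p] p by simp
  moreover have "(local_rep b (coord c) has_derivative jacobian b c p) (at (coord b p))"
    using transition_has_derivative[OF A(1-3), of p] p by simp
  ultimately have "((\<lambda>x. local_rep c (coord d) (local_rep b (coord c) x)) has_derivative
      (\<lambda>u. jacobian c d p (jacobian b c p u))) (at (coord b p))"
    using diff_chain_at[unfolded o_def] by blast
  then have "(local_rep b (coord d) has_derivative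
      (\<lambda>u. jacobian c d p (jacobian b c p u))) (at (coord b p))"
  proof (rule has_derivative_transform_within_open[OF _ S])
    fix x assume "x \<in> ?S"
    then obtain q where q: "q \<in> chart_dom b" "q \<in> chart_dom c" "q \<in> chart_dom d" "x = coord b q"
      by blast
    then show "local_rep c (coord d) (local_rep b (coord c) x) = local_rep b (coord d) x"
      by (simp add: local_rep_coord[OF ch(1)] local_rep_coord[OF ch(2)])
  qed
  then show ?thesis
    using has_derivative_unique[OF transition_has_derivative[OF A(1,2,4), of p]] p
    by (metis Int_iff)
qed

text \<open>
  Extend \<open>u\<close> to a field with constant coordinates in the chart \<open>b\<close>, multiply it by a bump function
  supported in a ball of the coordinate domain, and extend by zero. Smoothness of the extension is
  where the Hausdorff property enters: the preimage \<open>K\<close> of the ball is compact, hence closed in \<open>M\<close>,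
  so that the field vanishes on a neighbourhood of each point outside the chart.
\<close>

lemma vector_field_extending_vector_exists:
  assumes H: "Hausdorff_space M" and A: "oriented_atlas M A" "b \<in> A"
    and p: "p \<in> chart_dom b"
  obtains X where "vector_field A X" "X b p = u"
proof -
  have chart: "is_chart M c" if "c \<in> A" for c using A(1) that unfolding oriented_atlas_def by blast
  have dom: "openin M (chart_dom c)" if "c \<in> A" for c using chart[OF that] unfolding is_chart_def by blast
  obtain r where r: "r > 0" "cball (coord b p) r \<subseteq> coord_dom b"
    using chart[OF A(2)] p open_contains_cball unfolding is_chart_def by blast
  obtain \<beta> :: "real^3 \<Rightarrow> real" where \<beta>: "smooth_on UNIV \<beta>" "\<beta> (coord b p) = 1"
    "\<forall>x. x \<notin> cball (coord b p) r \<longrightarrow> \<beta> x = 0"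
    using smooth_bump_exists[OF r(1)] by blast
  define K where "K = {q \<in> chart_dom b. coord b q \<in> cball (coord b p) r}"
  have K: "openin M (topspace M - K)"
    using compactin_imp_closedin[OF H compactin_chart_preimage[OF chart[OF A(2)] compact_cball r(2)]]
    unfolding K_def closedin_def by blast
  define X where "X c q = (if q \<in> chart_dom b then \<beta> (coord b q) *\<^sub>R jacobian b c q u else 0)" for c q
  have "smooth_on (coord_dom c) (local_rep c (X c))" if c: "c \<in> A" for c
    unfolding smooth_on_def
  proof (intro allI higher_differentiable_on_locally)
    fix n x assume "x \<in> coord_dom c"
    then obtain q where q: "q \<in> chart_dom c" "x = coord c q" by blast
    show "\<exists>U. open U \<and> x \<in> U \<and> higher_differentiable_on n (coord_dom c \<inter> U) (local_rep c (X c))"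
    proof (cases "q \<in> chart_dom b")
      case True
      \<comment> \<open>On the overlap the field is the composition of the change of coordinates \<open>?h\<close> with the
        product of the bump function and the derivative \<open>?D\<close> of the inverse change.\<close>
      let ?U = "coord c ` (chart_dom c \<inter> chart_dom b)" and ?W = "coord b ` (chart_dom b \<inter> chart_dom c)"
      let ?h = "local_rep c (coord b)"
      let ?D = "\<lambda>y. frechet_derivative (local_rep b (coord c)) (at y within ?W) u"
      have U: "open ?U" "open ?W" using open_chart_image chart dom A(2) c by blast+
      have uU: "unique_diff ?U" using unique_diff_open U(1) .
      have h: "higher_differentiable_on n ?U ?h"
        using A c unfolding oriented_atlas_def smooth_on_def by blast
      have hU: "?h ` ?U \<subseteq> ?W" 
        using local_rep_coord[OF chart[OF c], where f = "coord b"] by (auto simp: image_subset_iff)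
      have "higher_differentiable_on (Suc n) ?W (local_rep b (coord c))"
        using A c unfolding oriented_atlas_def smooth_on_def by blast
      from higher_differentiable_on_SucD(2)[OF this]
      have D: "higher_differentiable_on n ?W ?D" .
      have "higher_differentiable_on n ?U (\<lambda>x. \<beta> (?h x) *\<^sub>R ?D (?h x))"
        by (rule higher_differentiable_on_bilinear[OF bounded_bilinear_scaleR uU
              higher_differentiable_on_compose[OF uU subset_UNIV \<beta>(1)[unfolded smooth_on_def, rule_format] h]
              higher_differentiable_on_compose[OF uU hU D h]])
      moreover have "local_rep c (X c) y = \<beta> (?h y) *\<^sub>R ?D (?h y)" if "y \<in> ?U" for y
      proof -
        obtain z where z: "z \<in> chart_dom c" "z \<in> chart_dom b" "y = coord c z" using \<open>y \<in> ?U\<close> by blast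
        have "at (coord b z) within ?W = at (coord b z)"
          by (rule at_within_open[OF _ U(2)]) (use z in blast)
        moreover have "?h y = coord b z" "local_rep c (X c) y = X c z"
          unfolding z(3) by (rule local_rep_coord[OF chart[OF c] z(1)])+
        ultimately show ?thesis
          using z(2) by (simp add: X_def jacobian_def)
      qed
      ultimately have "higher_differentiable_on n ?U (local_rep c (X c))"
        by (subst higher_differentiable_on_cong)
      moreover have "coord_dom c \<inter> ?U = ?U" by blast
      ultimately show ?thesis using U(1) q True by (intro exI[of _ ?U]) auto
    next
      case False
      let ?U = "coord c ` (chart_dom c \<inter> (topspace M - K))"
      have U: "open ?U" using open_chart_image[OF chart[OF c] K] .
      have "local_rep c (X c) y = 0" if "y \<in> ?U" for y
      proof -
        obtain z where z: "z \<in> chart_dom c" "z \<notin> K" "y = coord c z" using \<open>y \<in> ?U\<close> by blast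
        have "local_rep c (X c) y = X c z"
          unfolding z(3) by (rule local_rep_coord[OF chart[OF c] z(1)])
        then show ?thesis using z(2) \<beta>(3) by (auto simp: X_def K_def)
      qed
      then have "higher_differentiable_on n ?U (local_rep c (X c))"
        using higher_differentiable_on_const[OF unique_diff_open[OF U]]
        by (subst higher_differentiable_on_cong)
      moreover have "coord_dom c \<inter> ?U = ?U" by blast
      moreover have "x \<in> ?U"
        using q False openin_subset[OF dom[OF c]] by (auto simp: K_def)
      ultimately show ?thesis using U by (intro exI[of _ ?U]) auto
    qed
  qed
  moreover have "X d q = jacobian c d q (X c q)"
    if "c \<in> A" "d \<in> A" "q \<in> chart_dom c \<inter> chart_dom d" for c d q
  proof -
    interpret J: bounded_linear "jacobian c d q"
      using transition_has_derivative[OF A(1) that] has_derivative_bounded_linear by blast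
    show ?thesis
      using jacobian_compose[OF A that(1,2), of q] that(3) by (simp add: X_def J.scaleR J.zero)
  qed
  ultimately have "vector_field A X" unfolding vector_field_def by blast
  moreover have "X b p = u"
  proof -
    have "(local_rep b (coord b) has_derivative (\<lambda>v. v)) (at (coord b p))"
      by (rule has_derivative_transform_within_open[OF has_derivative_ident, of "coord_dom b"])
         (use chart[OF A(2)] p local_rep_coord in \<open>auto simp: is_chart_def local_rep_def f_inv_into_f\<close>)
    then have "jacobian b b p = (\<lambda>v. v)" unfolding jacobian_def by (rule frechet_derivative_at[symmetric])
    then show ?thesis using p \<beta>(2) by (simp add: X_def)
  qed
  ultimately show ?thesis using that by blast
qed

text \<open>
  The covariant derivative depends on \<open>X\<close> only through its value at the point, and every tangent
  vector is the value of a global field. So the defining equation, which quantifies over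
  global fields, holds for single vectors, such as the velocity of a curve.
\<close>

lemma concircular_field_derivative:
  assumes "Hausdorff_space M" "oriented_atlas M A" "concircular_field A g V \<rho>"
    and "c \<in> A" "p \<in> chart_dom c"
  shows "frechet_derivative (local_rep c (V c)) (at (coord c p)) u + christoffel_term g c p u (V c p)
     = \<rho> p *\<^sub>R u"
proof -
  obtain X where "vector_field A X" "X c p = u"
    using vector_field_extending_vector_exists[OF assms(1,2,4,5)] by blast
  then show ?thesis
    using assms(3-5) unfolding concircular_field_def cov_deriv_def by fastforce
qed

section \<open>Derivatives with respect to the parameter of a curve\<close>

lemma has_vector_derivative_curve_deriv:
  assumes "f differentiable (at s within J)"
  shows "(f has_vector_derivative curve_deriv J f s) (at s within J)"
  using assms vector_derivative_works unfolding curve_deriv_def by blast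

lemma curve_deriv_eq:
  assumes "unique_diff J" "s \<in> J" "(f has_vector_derivative f') (at s within J)"
  shows "curve_deriv J f s = f'"
proof -
  have "(f has_vector_derivative curve_deriv J f s) (at s within J)"
    using assms(3) has_vector_derivative_curve_deriv differentiableI_vector by blast
  then have "(\<lambda>h. h *\<^sub>R curve_deriv J f s) = (\<lambda>h. h *\<^sub>R f')"
    using frechet_derivative_within_eq[OF assms(1,2)] assms(3)
    unfolding has_vector_derivative_def by metis
  then show ?thesis by (metis scaleR_one)
qed

lemma DERIV_unique_within:
  assumes "unique_diff J" "s \<in> J"
    and "(f has_real_derivative a) (at s within J)" "(f has_real_derivative b) (at s within J)"
  shows "a = b"
  using curve_deriv_eq[OF assms(1,2)] assms(3,4)
  unfolding has_real_derivative_iff_has_vector_derivative by blast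

lemma curve_deriv_cong:
  assumes "\<And>t. t \<in> J \<Longrightarrow> f t = h t" "s \<in> J"
  shows "curve_deriv J f s = curve_deriv J h s"
proof -
  have "(f has_vector_derivative D) (at s within J) \<longleftrightarrow> (h has_vector_derivative D) (at s within J)" for D
    using has_vector_derivative_transform[OF assms(2), of f h]
      has_vector_derivative_transform[OF assms(2), of h f] assms(1) by auto
  then show ?thesis unfolding curve_deriv_def vector_derivative_def by presburger
qed

lemma higher_differentiable_on_curve_deriv:
  assumes "unique_diff J" "higher_differentiable_on (Suc n) J f"
  shows "higher_differentiable_on n J (curve_deriv J f)"
proof -
  have "frechet_derivative f (at s within J) 1 = curve_deriv J f s" if "s \<in> J" for s
    using has_vector_derivative_curve_deriv[of f s J] assms(2) that
      frechet_derivative_within_eq[OF assms(1) that]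
    by (fastforce simp: has_vector_derivative_def)
  then show ?thesis
    using higher_differentiable_on_SucD(2)[OF assms(2), of 1]
    by (subst higher_differentiable_on_cong[where g = "\<lambda>s. frechet_derivative f (at s within J) 1"]) auto
qed

section \<open>Christoffel symbols with all indices lowered\<close>

text \<open>
  The vector of Christoffel symbols of the first kind, contracted with \<open>u\<close> and \<open>v\<close>. It is linear in
  the first derivatives of the metric and free of the inverse matrix, so that its smoothness along a
  curve is that of sums and products.
\<close>

definition christoffel_lowered ::
  "'a metric_coeffs \<Rightarrow> 'a chart \<Rightarrow> 'a \<Rightarrow> real^3 \<Rightarrow> real^3 \<Rightarrow> real^3" where
  "christoffel_lowered g c p u v = (\<chi> l. (1/2) * (\<Sum>i\<in>UNIV. \<Sum>j\<in>UNIV.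
     (partial_deriv c i (\<lambda>q. g c q $ j $ l) p
      + partial_deriv c j (\<lambda>q. g c q $ i $ l) p
      - partial_deriv c l (\<lambda>q. g c q $ i $ j) p) * u $ i * v $ j))"

lemma christoffel_term_eq_matrix_inv:
  "christoffel_term g c p u v = matrix_inv (g c p) *v christoffel_lowered g c p u v"
proof -
  define a where "a i j l = partial_deriv c i (\<lambda>q. g c q $ j $ l) p
      + partial_deriv c j (\<lambda>q. g c q $ i $ l) p - partial_deriv c l (\<lambda>q. g c q $ i $ j) p" for i j l
  show ?thesis
    by (simp add: vec_eq_iff christoffel_term_def christoffel_def christoffel_lowered_def
        matrix_vector_mult_def a_def[symmetric] sum_3 algebra_simps)
qed

lemma metric_inner_christoffel_term:
  assumes "invertible (g c p)"
  shows "metric_inner g c p w (christoffel_term g c p u v) = w \<bullet> christoffel_lowered g c p u v"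
proof -
  have "g c p ** matrix_inv (g c p) = mat 1"
    using someI_ex[OF assms[unfolded invertible_def]] unfolding matrix_inv_def by blast
  then show ?thesis
    by (simp add: metric_inner_def christoffel_term_eq_matrix_inv matrix_vector_mul_assoc)
qed

text \<open>
  Compatibility of the connection with the metric, at the level of symbols: after exchanging the
  summation indices \<open>j\<close> and \<open>l\<close> in the second term, all partial derivatives cancel except two equal
  copies of the derivative of the metric in the direction \<open>u\<close>.
\<close>

lemma christoffel_lowered_metric:
  assumes "\<And>i j l. partial_deriv c i (\<lambda>q. g c q $ j $ l) p = partial_deriv c i (\<lambda>q. g c q $ l $ j) p"
  shows "w \<bullet> christoffel_lowered g c p u v + v \<bullet> christoffel_lowered g c p u w =
    (\<Sum>j\<in>UNIV. \<Sum>l\<in>UNIV. v $ j * (\<Sum>i\<in>UNIV. u $ i * partial_deriv c i (\<lambda>q. g c q $ j $ l) p) * w $ l)"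
proof -
  define D where "D i j l = partial_deriv c i (\<lambda>q. g c q $ j $ l) p" for i j l
  let ?S = "\<lambda>f. \<Sum>j\<in>UNIV. \<Sum>l\<in>UNIV. \<Sum>i\<in>UNIV. f i j l :: real"
  have sym: "D i l j = D i j l" for i j l unfolding D_def by (rule assms)
  have swap: "?S f = ?S (\<lambda>i j l. f i l j)" for f by (rule sum.swap)
  have low: "x \<bullet> christoffel_lowered g c p u y
      = (1/2) * ?S (\<lambda>i j l. (D i j l + D j i l - D l i j) * (u $ i * y $ j * x $ l))" for x y
  proof -
    have "x \<bullet> christoffel_lowered g c p u y = (\<Sum>l\<in>UNIV. \<Sum>i\<in>UNIV. \<Sum>j\<in>UNIV.
        (1/2) * ((D i j l + D j i l - D l i j) * (u $ i * y $ j * x $ l)))"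
      by (simp add: christoffel_lowered_def inner_vec_def D_def sum_distrib_left sum_distrib_right mult_ac)
    also have "\<dots> = (\<Sum>l\<in>UNIV. \<Sum>j\<in>UNIV. \<Sum>i\<in>UNIV.
        (1/2) * ((D i j l + D j i l - D l i j) * (u $ i * y $ j * x $ l)))"
      by (rule sum.cong[OF refl sum.swap])
    also have "\<dots> = (\<Sum>j\<in>UNIV. \<Sum>l\<in>UNIV. \<Sum>i\<in>UNIV.
        (1/2) * ((D i j l + D j i l - D l i j) * (u $ i * y $ j * x $ l)))"
      by (rule sum.swap)
    finally show ?thesis by (simp add: sum_distrib_left)
  qed
  have "w \<bullet> christoffel_lowered g c p u v + v \<bullet> christoffel_lowered g c p u w =
      (1/2) * (?S (\<lambda>i j l. (D i j l + D j i l - D l i j) * (u $ i * v $ j * w $ l))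
      + ?S (\<lambda>i j l. (D i l j + D l i j - D j i l) * (u $ i * w $ l * v $ j)))"
    unfolding low swap[of "\<lambda>i j l. (D i j l + D j i l - D l i j) * (u $ i * w $ j * v $ l)"]
    by (simp add: algebra_simps)
  also have "\<dots> = ?S (\<lambda>i j l. D i j l * (u $ i * v $ j * w $ l))"
    unfolding sum.distrib[symmetric] sum_distrib_left
    by (intro sum.cong refl) (simp add: sym algebra_simps)
  finally show ?thesis by (simp add: D_def sum_distrib_left sum_distrib_right mult_ac)
qed

section \<open>Curves inside a chart\<close>

lemma metric_inner_sum:
  "metric_inner g c p v w = (\<Sum>j\<in>UNIV. \<Sum>l\<in>UNIV. v $ j * (g c p $ j $ l * w $ l))"
  by (simp add: metric_inner_def inner_vec_def matrix_vector_mult_def sum_distrib_left)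

text \<open>
  The identity to be proved is local in the parameter, so it is enough to work on the set \<open>J\<close> of
  parameters whose points lie in one chart. There a field along the curve is an ordinary
  vector-valued function, and by \<open>at_within\<close> derivatives within \<open>I\<close> and within \<open>J\<close> coincide.
\<close>

locale curve_in_chart =
  fixes M :: "'a topology" and c :: "'a chart" and g :: "'a metric_coeffs"
    and I J :: "real set" and \<gamma> :: "real \<Rightarrow> 'a"
  assumes chart: "is_chart M c"
    and smooth_metric: "smooth_on (coord_dom c) (local_rep c (g c))"
    and metric_transpose: "\<And>p. p \<in> chart_dom c \<Longrightarrow> transpose (g c p) = g c p"
    and metric_pos: "\<And>p v. p \<in> chart_dom c \<Longrightarrow> v \<noteq> 0 \<Longrightarrow> metric_inner g c p v v > 0"
    and unique_diff: "unique_diff J"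
    and at_within: "\<And>s. s \<in> J \<Longrightarrow> at s within I = at s within J"
    and in_dom: "\<And>s. s \<in> J \<Longrightarrow> \<gamma> s \<in> chart_dom c"
    and smooth_path: "smooth_on J (\<lambda>s. coord c (\<gamma> s))"
begin

lemma curve_deriv_restrict: "s \<in> J \<Longrightarrow> curve_deriv I f s = curve_deriv J f s"
  by (simp add: curve_deriv_def at_within)

lemma open_coord_dom: "open (coord_dom c)"
  using chart by (simp add: is_chart_def)

lemma higher_differentiable_curve: "higher_differentiable_on n J (\<lambda>s. coord c (\<gamma> s))"
  using smooth_path by (simp add: smooth_on_def)

lemma curve_has_velocity:
  assumes "s \<in> J"
  shows "((\<lambda>s. coord c (\<gamma> s)) has_vector_derivative velocity I \<gamma> c s) (at s within J)"
  using has_vector_derivative_curve_deriv[of "\<lambda>s. coord c (\<gamma> s)" s J]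
    higher_differentiable_curve[of "Suc 0"] assms
  by (simp add: velocity_def curve_deriv_restrict)

lemma smooth_velocity: "smooth_on J (velocity I \<gamma> c)"
  unfolding smooth_on_def
proof
  fix n
  show "higher_differentiable_on n J (velocity I \<gamma> c)"
    using higher_differentiable_on_curve_deriv[OF unique_diff higher_differentiable_curve]
    by (subst higher_differentiable_on_cong[where g = "curve_deriv J (\<lambda>s. coord c (\<gamma> s))"])
       (simp_all add: velocity_def curve_deriv_restrict)
qed

lemma coord_function_has_derivative:
  fixes F :: "real^3 \<Rightarrow> 'b::euclidean_space"
  assumes F: "smooth_on (coord_dom c) F" and p: "p \<in> chart_dom c"
  shows "(F has_derivative frechet_derivative F (at (coord c p))) (at (coord c p))"
proof -
  have "higher_differentiable_on (Suc 0) (coord_dom c) F" using F unfolding smooth_on_def by blast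
  from higher_differentiable_on_SucD(1)[OF this, of "coord c p"] p show ?thesis
    using at_within_open[OF _ open_coord_dom, of "coord c p"] by simp
qed

lemma coord_function_along_has_derivative:
  fixes F :: "real^3 \<Rightarrow> 'b::euclidean_space"
  assumes F: "smooth_on (coord_dom c) F" and s: "s \<in> J"
  shows "((\<lambda>s. F (coord c (\<gamma> s))) has_vector_derivative
    frechet_derivative F (at (coord c (\<gamma> s))) (velocity I \<gamma> c s)) (at s within J)"
  using vector_derivative_diff_chain_within[OF curve_has_velocity[OF s]
      has_derivative_at_withinI[OF coord_function_has_derivative[OF F in_dom[OF s]]]]
  by (simp add: o_def)

lemma coord_function_along_differentiable:
  assumes "smooth_on (coord_dom c) F"
  shows "higher_differentiable_on n J (\<lambda>s. F (coord c (\<gamma> s)))"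
  by (rule higher_differentiable_on_compose[OF unique_diff _ _ higher_differentiable_curve,
        where R = "coord_dom c"])
     (use assms in_dom in \<open>auto simp: smooth_on_def\<close>)

lemma coord_derivative_along_differentiable:
  fixes F :: "real^3 \<Rightarrow> 'b::euclidean_space"
  assumes "smooth_on (coord_dom c) F"
  shows "higher_differentiable_on n J (\<lambda>s. frechet_derivative F (at (coord c (\<gamma> s))) w)"
proof -
  let ?D = "\<lambda>x. frechet_derivative F (at x within coord_dom c) w"
  have "higher_differentiable_on (Suc n) (coord_dom c) F" using assms unfolding smooth_on_def by blast
  note D = higher_differentiable_on_SucD(2)[OF this, of w]
  have "higher_differentiable_on n J (\<lambda>s. ?D (coord c (\<gamma> s)))"
    by (rule higher_differentiable_on_compose[OF unique_diff _ D higher_differentiable_curve])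
       (use in_dom in auto)
  then show ?thesis
    by (subst higher_differentiable_on_cong[where g = "\<lambda>s. ?D (coord c (\<gamma> s))"])
       (simp_all add: at_within_open[OF _ open_coord_dom] in_dom)
qed

lemma smooth_metric_coeff: "smooth_on (coord_dom c) (local_rep c (\<lambda>q. g c q $ j $ l))"
proof -
  have "higher_differentiable_on n (coord_dom c) (\<lambda>x. local_rep c (g c) x $ j $ l)" for n
    by (intro higher_differentiable_on_linear[OF bounded_linear_vec_nth unique_diff_open[OF open_coord_dom]])
       (use smooth_metric in \<open>simp add: smooth_on_def\<close>)
  then show ?thesis by (simp add: smooth_on_def local_rep_def o_def)
qed

lemma metric_coeff_along:
  "s \<in> J \<Longrightarrow> g c (\<gamma> s) $ j $ l = local_rep c (\<lambda>q. g c q $ j $ l) (coord c (\<gamma> s))"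
  by (subst local_rep_coord[OF chart in_dom]) simp_all

lemma metric_coeff_symmetric: "p \<in> chart_dom c \<Longrightarrow> g c p $ j $ l = g c p $ l $ j"
  using metric_transpose[of p] by (simp add: vec_eq_iff transpose_def)

lemma metric_inner_commute: "p \<in> chart_dom c \<Longrightarrow> metric_inner g c p v w = metric_inner g c p w v"
  unfolding metric_inner_def
  using metric_transpose[of p] dot_lmul_matrix[of v "g c p" w] transpose_matrix_vector[of "g c p" v]
  by (simp add: inner_commute)

lemma partial_metric_coeff_symmetric:
  assumes p: "p \<in> chart_dom c"
  shows "partial_deriv c i (\<lambda>q. g c q $ j $ l) p = partial_deriv c i (\<lambda>q. g c q $ l $ j) p"
proof -
  have "local_rep c (\<lambda>q. g c q $ j $ l) x = local_rep c (\<lambda>q. g c q $ l $ j) x"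
    if "x \<in> coord_dom c" for x
    using that metric_coeff_symmetric by (auto simp: local_rep_coord[OF chart])
  then have "frechet_derivative (local_rep c (\<lambda>q. g c q $ j $ l)) (at (coord c p) within coord_dom c)
      = frechet_derivative (local_rep c (\<lambda>q. g c q $ l $ j)) (at (coord c p) within coord_dom c)"
    by (rule frechet_derivative_within_cong) (use p in auto)
  then show ?thesis
    using p at_within_open[OF _ open_coord_dom, of "coord c p"] by (simp add: partial_deriv_def)
qed

lemma invertible_metric:
  assumes "p \<in> chart_dom c" shows "invertible (g c p)"
proof -
  have "v = 0" if "g c p *v v = 0" for v
    using metric_pos[OF assms, of v] that by (auto simp: metric_inner_def)
  then have "\<exists>B. B ** g c p = mat 1" by (simp add: matrix_left_invertible_ker)
  then show ?thesis by (simp add: invertible_left_inverse)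
qed

lemma metric_coeff_along_has_derivative:
  assumes s: "s \<in> J"
  shows "((\<lambda>s. g c (\<gamma> s) $ j $ l) has_real_derivative
    (\<Sum>i\<in>UNIV. velocity I \<gamma> c s $ i * partial_deriv c i (\<lambda>q. g c q $ j $ l) (\<gamma> s))) (at s within J)"
proof -
  let ?F = "local_rep c (\<lambda>q. g c q $ j $ l)"
  let ?D = "frechet_derivative ?F (at (coord c (\<gamma> s)))" and ?T = "velocity I \<gamma> c s"
  interpret D: bounded_linear ?D
    using coord_function_has_derivative[OF smooth_metric_coeff in_dom[OF s]]
    by (rule has_derivative_bounded_linear)
  have "?D ?T = ?D (\<Sum>i\<in>UNIV. ?T $ i *\<^sub>R axis i 1)"
    using basis_expansion[of ?T] by (simp add: scalar_mult_eq_scaleR)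
  also have "\<dots> = (\<Sum>i\<in>UNIV. ?T $ i * partial_deriv c i (\<lambda>q. g c q $ j $ l) (\<gamma> s))"
    by (simp add: D.sum D.scaleR partial_deriv_def)
  finally have eq: "?D ?T = (\<Sum>i\<in>UNIV. ?T $ i * partial_deriv c i (\<lambda>q. g c q $ j $ l) (\<gamma> s))" .
  have "((\<lambda>s. ?F (coord c (\<gamma> s))) has_real_derivative
      (\<Sum>i\<in>UNIV. ?T $ i * partial_deriv c i (\<lambda>q. g c q $ j $ l) (\<gamma> s))) (at s within J)"
    using coord_function_along_has_derivative[OF smooth_metric_coeff s, of j l]
    unfolding eq has_real_derivative_iff_has_vector_derivative .
  then show ?thesis
    by (rule has_field_derivative_transform_within[OF _ zero_less_one s]) (simp add: metric_coeff_along)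
qed

lemma component_has_derivative:
  fixes W :: "real \<Rightarrow> real^3"
  assumes "smooth_on J W" "s \<in> J"
  shows "((\<lambda>s. W s $ j) has_real_derivative curve_deriv I W s $ j) (at s within J)"
proof -
  have "higher_differentiable_on (Suc 0) J W" using assms(1) unfolding smooth_on_def by blast
  then have "W differentiable (at s within J)" using assms(2) by simp
  then have "(W has_vector_derivative curve_deriv I W s) (at s within J)"
    using has_vector_derivative_curve_deriv assms(2) by (simp only: curve_deriv_restrict)
  from bounded_linear.has_vector_derivative[OF bounded_linear_vec_nth this] show ?thesis
    by (simp add: has_real_derivative_iff_has_vector_derivative)
qed

lemma metric_inner_cov_deriv:
  assumes s: "s \<in> J"
  shows "metric_inner g c (\<gamma> s) v (cov_deriv_along g I \<gamma> W c s) =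
    metric_inner g c (\<gamma> s) v (curve_deriv I (W c) s)
    + v \<bullet> christoffel_lowered g c (\<gamma> s) (velocity I \<gamma> c s) (W c s)"
proof -
  have "metric_inner g c (\<gamma> s) v (cov_deriv_along g I \<gamma> W c s) =
    metric_inner g c (\<gamma> s) v (curve_deriv I (W c) s)
    + metric_inner g c (\<gamma> s) v (christoffel_term g c (\<gamma> s) (velocity I \<gamma> c s) (W c s))"
    by (simp add: metric_inner_def cov_deriv_along_def matrix_vector_right_distrib inner_right_distrib)
  then show ?thesis using metric_inner_christoffel_term invertible_metric[OF in_dom[OF s]] by metis
qed

text \<open>
  The product rule for the Levi-Civita derivative along the curve. The product rule in coordinates
  leaves the derivative of the metric coefficients; \<open>christoffel_lowered_metric\<close> splits it into the
  Christoffel terms of the two covariant derivatives.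
\<close>

lemma metric_inner_along_has_derivative:
  assumes W: "smooth_on J (W c)" and Z: "smooth_on J (Z c)" and s: "s \<in> J"
  shows "((\<lambda>s. metric_inner g c (\<gamma> s) (W c s) (Z c s)) has_real_derivative
    metric_inner g c (\<gamma> s) (cov_deriv_along g I \<gamma> W c s) (Z c s)
    + metric_inner g c (\<gamma> s) (W c s) (cov_deriv_along g I \<gamma> Z c s)) (at s within J)"
proof -
  let ?W' = "curve_deriv I (W c) s" and ?Z' = "curve_deriv I (Z c) s" and ?T = "velocity I \<gamma> c s"
  let ?G = "g c (\<gamma> s)" and ?ip = "metric_inner g c (\<gamma> s)"
  let ?G' = "\<lambda>j l. \<Sum>i\<in>UNIV. ?T $ i * partial_deriv c i (\<lambda>q. g c q $ j $ l) (\<gamma> s)"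
  note sym = metric_inner_commute[OF in_dom[OF s]]
  have "((\<lambda>s. metric_inner g c (\<gamma> s) (W c s) (Z c s)) has_real_derivative
      (\<Sum>j\<in>UNIV. \<Sum>l\<in>UNIV. ?W' $ j * (?G $ j $ l * Z c s $ l)
        + (?G' j l * Z c s $ l + ?Z' $ l * ?G $ j $ l) * W c s $ j)) (at s within J)"
    unfolding metric_inner_sum
    by (intro DERIV_sum DERIV_mult component_has_derivative metric_coeff_along_has_derivative W Z s)
  moreover have "(\<Sum>j\<in>UNIV. \<Sum>l\<in>UNIV. ?W' $ j * (?G $ j $ l * Z c s $ l)
        + (?G' j l * Z c s $ l + ?Z' $ l * ?G $ j $ l) * W c s $ j)
      = ?ip ?W' (Z c s) + ?ip (W c s) ?Z' + (\<Sum>j\<in>UNIV. \<Sum>l\<in>UNIV. W c s $ j * ?G' j l * Z c s $ l)"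
    unfolding metric_inner_sum sum.distrib[symmetric]
    by (intro sum.cong refl) (simp only: algebra_simps)
  moreover have "?ip (cov_deriv_along g I \<gamma> W c s) (Z c s) + ?ip (W c s) (cov_deriv_along g I \<gamma> Z c s)
      = ?ip ?W' (Z c s) + ?ip (W c s) ?Z' + (\<Sum>j\<in>UNIV. \<Sum>l\<in>UNIV. W c s $ j * ?G' j l * Z c s $ l)"
    using christoffel_lowered_metric[where g = g and c = c and p = "\<gamma> s" and w = "Z c s" and u = ?T
        and v = "W c s"] partial_metric_coeff_symmetric[OF in_dom[OF s]]
    by (simp add: sym[of "cov_deriv_along g I \<gamma> W c s"] sym[of ?W'] metric_inner_cov_deriv[OF s])
  ultimately show ?thesis by simp
qed

text \<open>
  Curvature and torsion are inner products of this kind, so this provides their regularity.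
\<close>

lemma metric_inner_cov_deriv_differentiable:
  assumes W: "smooth_on J (W c)" and Z: "smooth_on J (Z c)"
  shows "higher_differentiable_on n J (\<lambda>s. metric_inner g c (\<gamma> s) (Z c s) (cov_deriv_along g I \<gamma> W c s))"
proof -
  have comp: "higher_differentiable_on n J (\<lambda>s. U s $ j)" if "smooth_on J U" for U :: "real \<Rightarrow> real^3" and j
    by (rule higher_differentiable_on_linear[OF bounded_linear_vec_nth unique_diff])
       (use that in \<open>simp add: smooth_on_def\<close>)
  have "smooth_on J (curve_deriv J (W c))"
    using W higher_differentiable_on_curve_deriv[OF unique_diff] unfolding smooth_on_def by blast
  note W' = comp[OF this]
  have G: "higher_differentiable_on n J (\<lambda>s. g c (\<gamma> s) $ j $ l)" for j l
    using coord_function_along_differentiable[OF smooth_metric_coeff]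
    by (subst higher_differentiable_on_cong[OF metric_coeff_along]) auto
  have dG: "higher_differentiable_on n J (\<lambda>s. partial_deriv c i (\<lambda>q. g c q $ j $ l) (\<gamma> s))" for i j l
    unfolding partial_deriv_def by (rule coord_derivative_along_differentiable[OF smooth_metric_coeff])
  have "higher_differentiable_on n J (\<lambda>s.
      (\<Sum>j\<in>UNIV. \<Sum>l\<in>UNIV. Z c s $ j * (g c (\<gamma> s) $ j $ l * curve_deriv J (W c) s $ l))
      + (\<Sum>l\<in>UNIV. Z c s $ l * ((1/2) * (\<Sum>i\<in>UNIV. \<Sum>j\<in>UNIV.
         (partial_deriv c i (\<lambda>q. g c q $ j $ l) (\<gamma> s)
          + partial_deriv c j (\<lambda>q. g c q $ i $ l) (\<gamma> s)
          + (-1) * partial_deriv c l (\<lambda>q. g c q $ i $ j) (\<gamma> s))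
         * velocity I \<gamma> c s $ i * W c s $ j))))"
    by (intro higher_differentiable_on_add higher_differentiable_on_sum higher_differentiable_on_mult
        higher_differentiable_on_const unique_diff comp[OF Z] comp[OF W] comp[OF smooth_velocity] W' G dG)
  then show ?thesis
    by (rule higher_differentiable_on_cong[THEN iffD1, rotated])
       (subst metric_inner_cov_deriv, assumption,
         simp add: metric_inner_sum christoffel_lowered_def inner_vec_def curve_deriv_restrict)
qed

end

section \<open>Concircular curves\<close>

lemma curve_in_chart_of_smooth_curve:
  assumes A: "oriented_atlas M A" "c \<in> A" and g: "riemannian_metric A g"
    and \<gamma>: "smooth_curve M A I \<gamma>"
  shows "curve_in_chart M c g I {s \<in> I. \<gamma> s \<in> chart_dom c} \<gamma>"
proof -
  let ?J = "{s \<in> I. \<gamma> s \<in> chart_dom c}"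
  have c: "is_chart M c" using A unfolding oriented_atlas_def by blast
  then have "openin (top_of_set I) {s \<in> topspace (top_of_set I). \<gamma> s \<in> chart_dom c}"
    using \<gamma> openin_continuous_map_preimage unfolding smooth_curve_def is_chart_def by blast
  then obtain U where U: "open U" "?J = I \<inter> U" by (auto simp: openin_open)
  show ?thesis
  proof
    show "unique_diff ?J"
      unfolding U(2) using \<gamma> unique_diff_interval_Int_open U(1) unfolding smooth_curve_def by blast
    show "at s within I = at s within ?J" if "s \<in> ?J" for s
      by (rule at_within_nhd[of _ U]) (use that U in auto)
    show "smooth_on (coord_dom c) (local_rep c (g c))"
      and "p \<in> chart_dom c \<Longrightarrow> transpose (g c p) = g c p"
      and "p \<in> chart_dom c \<Longrightarrow> v \<noteq> 0 \<Longrightarrow> metric_inner g c p v v > 0" for p v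
      using g A(2) unfolding riemannian_metric_def by blast+
    show "smooth_on ?J (\<lambda>s. coord c (\<gamma> s))" using \<gamma> A(2) unfolding smooth_curve_def by blast
  qed (use c in auto)
qed

lemma metric_inner_algebra:
  "metric_inner g c p (a *\<^sub>R v) w = a * metric_inner g c p v w"
  "metric_inner g c p v (a *\<^sub>R w) = a * metric_inner g c p v w"
  "metric_inner g c p v (w + z) = metric_inner g c p v w + metric_inner g c p v z"
  by (simp_all add: metric_inner_def matrix_vector_mult_scaleR matrix_vector_right_distrib inner_right_distrib)

text \<open>
  The analytic core, with \<open>v\<close> and \<open>b\<close> the tangential and binormal components of the field and \<open>r\<close> the
  conformal scalar along the curve. Differentiating \<open>v = \<phi> b\<close> and using \<open>\<tau> = \<kappa> \<phi>\<close> gives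
  \<open>\<phi>' b = r + \<theta> \<kappa> (1 + \<phi>\<^sup>2)\<close>; the claim is the equation \<open>b' = - \<theta> \<tau>\<close> for this expression of \<open>b\<close>.
  Two derivatives of \<open>\<kappa>\<close> and \<open>\<tau>\<close> ensure that both summands of \<open>b\<close> are differentiable separately: that
  their sum is differentiable does not suffice for the equation with two derivative terms.
\<close>

lemma concircular_curve_ode:
  fixes \<kappa> \<tau> \<phi> r v b :: "real \<Rightarrow> real"
  assumes J: "unique_diff J"
    and \<kappa>: "higher_differentiable_on 2 J \<kappa>" "\<And>s. s \<in> J \<Longrightarrow> \<kappa> s \<noteq> 0"
    and \<tau>: "higher_differentiable_on 2 J \<tau>"
    and r: "higher_differentiable_on 1 J r"
    and \<phi>: "\<phi> = (\<lambda>s. \<tau> s / \<kappa> s)" "\<And>s. s \<in> J \<Longrightarrow> curve_deriv J \<phi> s \<noteq> 0"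
    and v: "\<And>s. s \<in> J \<Longrightarrow> (v has_real_derivative r s + \<theta> * \<kappa> s) (at s within J)"
    and b: "\<And>s. s \<in> J \<Longrightarrow> (b has_real_derivative - \<theta> * \<tau> s) (at s within J)"
    and vb: "\<And>s. s \<in> J \<Longrightarrow> \<kappa> s * v s = \<tau> s * b s"
    and s: "s \<in> J"
  shows "\<theta> * curve_deriv J (\<lambda>t. \<kappa> t * (1 + (\<phi> t)\<^sup>2) / curve_deriv J \<phi> t) s
      + curve_deriv J (\<lambda>t. r t / curve_deriv J \<phi> t) s + \<theta> * \<kappa> s * \<phi> s = 0"
proof -
  let ?\<phi>' = "curve_deriv J \<phi>" and ?\<kappa>' = "curve_deriv J \<kappa>" and ?\<tau>' = "curve_deriv J \<tau>"
  have diff: "\<kappa> differentiable (at t within J)" "\<tau> differentiable (at t within J)"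
    "r differentiable (at t within J)"
    "?\<kappa>' differentiable (at t within J)" "?\<tau>' differentiable (at t within J)" if "t \<in> J" for t
  proof -
    have k: "higher_differentiable_on (Suc 0) J ?\<kappa>'" and t: "higher_differentiable_on (Suc 0) J ?\<tau>'"
      using \<kappa>(1) \<tau> unfolding numeral_2_eq_2
      by (simp_all only: higher_differentiable_on_curve_deriv[OF J])
    show "\<kappa> differentiable (at t within J)" "\<tau> differentiable (at t within J)"
      "r differentiable (at t within J)"
      using \<kappa>(1) \<tau> r that by (simp_all add: numeral_2_eq_2)
    show "?\<kappa>' differentiable (at t within J)" "?\<tau>' differentiable (at t within J)"
      using k t that by simp_all
  qed
  have \<phi>_deriv: "(\<phi> has_real_derivative ?\<phi>' t) (at t within J)"
    and \<phi>'_eq: "?\<phi>' t = (?\<tau>' t * \<kappa> t - \<tau> t * ?\<kappa>' t) / (\<kappa> t * \<kappa> t)" if t: "t \<in> J" for t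
  proof -
    have "(\<phi> has_real_derivative (?\<tau>' t * \<kappa> t - \<tau> t * ?\<kappa>' t) / (\<kappa> t * \<kappa> t)) (at t within J)"
      unfolding \<phi>(1) using diff(1,2)[OF t, THEN has_vector_derivative_curve_deriv] \<kappa>(2)[OF t]
      by (intro DERIV_divide) (simp_all add: has_real_derivative_iff_has_vector_derivative)
    then have "(\<phi> has_vector_derivative (?\<tau>' t * \<kappa> t - \<tau> t * ?\<kappa>' t) / (\<kappa> t * \<kappa> t)) (at t within J)"
      by (simp only: has_real_derivative_iff_has_vector_derivative)
    from this curve_deriv_eq[OF J t this] show "?\<phi>' t = (?\<tau>' t * \<kappa> t - \<tau> t * ?\<kappa>' t) / (\<kappa> t * \<kappa> t)"
      "(\<phi> has_real_derivative ?\<phi>' t) (at t within J)"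
      by (simp_all only: has_real_derivative_iff_has_vector_derivative)
  qed
  have b_eq: "b t = \<theta> * (\<kappa> t * (1 + (\<phi> t)\<^sup>2) / ?\<phi>' t) + r t / ?\<phi>' t" if t: "t \<in> J" for t
  proof -
    have "((\<lambda>t. \<phi> t * b t) has_real_derivative r t + \<theta> * \<kappa> t) (at t within J)"
      using has_field_derivative_transform_within[OF v[OF t] zero_less_one t] vb \<kappa>(2)
      by (simp add: \<phi>(1) field_simps)
    moreover have "((\<lambda>t. \<phi> t * b t) has_real_derivative ?\<phi>' t * b t + (- \<theta> * \<tau> t) * \<phi> t) (at t within J)"
      by (rule DERIV_mult[OF \<phi>_deriv[OF t] b[OF t]])
    ultimately have "r t + \<theta> * \<kappa> t = ?\<phi>' t * b t + (- \<theta> * \<tau> t) * \<phi> t"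
      by (rule DERIV_unique_within[OF J t])
    moreover have "\<tau> t * \<phi> t = \<kappa> t * (\<phi> t)\<^sup>2"
      using \<kappa>(2)[OF t] by (simp add: \<phi>(1) power2_eq_square)
    ultimately have "?\<phi>' t * b t = \<theta> * (\<kappa> t * (1 + (\<phi> t)\<^sup>2)) + r t"
      by (simp add: algebra_simps)
    then show ?thesis using \<phi>(2)[OF t] by (simp add: field_simps)
  qed
  let ?f = "\<lambda>t. \<kappa> t * (1 + (\<phi> t)\<^sup>2) / ?\<phi>' t" and ?h = "\<lambda>t. r t / ?\<phi>' t"
  have \<phi>_diff: "\<phi> differentiable (at s within J)"
    using \<phi>_deriv[OF s] real_differentiable_def by blast
  have "(\<lambda>t. (?\<tau>' t * \<kappa> t - \<tau> t * ?\<kappa>' t) / (\<kappa> t * \<kappa> t)) differentiable (at s within J)"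
    by (intro differentiable_divide differentiable_diff differentiable_mult diff[OF s])
       (simp add: \<kappa>(2) s)
  then have \<phi>'_diff: "?\<phi>' differentiable (at s within J)"
    by (rule differentiable_transform_within[OF _ zero_less_one s]) (simp add: \<phi>'_eq)
  have fh: "(?f has_real_derivative curve_deriv J ?f s) (at s within J)"
    "(?h has_real_derivative curve_deriv J ?h s) (at s within J)"
    unfolding has_real_derivative_iff_has_vector_derivative
    by (intro has_vector_derivative_curve_deriv differentiable_divide differentiable_mult
        differentiable_add differentiable_power differentiable_const diff[OF s] \<phi>_diff \<phi>'_diff \<phi>(2) s)+
  have "((\<lambda>t. \<theta> * ?f t + ?h t) has_real_derivative \<theta> * curve_deriv J ?f s + curve_deriv J ?h s)
      (at s within J)"
    by (intro DERIV_add DERIV_cmult fh)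
  moreover have "((\<lambda>t. \<theta> * ?f t + ?h t) has_real_derivative - \<theta> * \<tau> s) (at s within J)"
    using has_field_derivative_transform_within[OF b[OF s] zero_less_one s] b_eq by simp
  ultimately have "\<theta> * curve_deriv J ?f s + curve_deriv J ?h s = - \<theta> * \<tau> s"
    by (rule DERIV_unique_within[OF J s])
  then show ?thesis using \<kappa>(2)[OF s] by (simp add: \<phi>(1))
qed

theorem theorem5p2:
  fixes M :: "'a topology" and A :: "'a chart set" and g :: "'a metric_coeffs"
    and V :: "'a field" and \<rho> :: "'a \<Rightarrow> real"
    and I :: "real set" and \<gamma> :: "real \<Rightarrow> 'a" and T N B :: "'a curve_field"
    and \<kappa> \<tau> \<phi> :: "real \<Rightarrow> real" and \<theta> :: real
  assumes "oriented_manifold M A" and "connected_space M" and "riemannian_metric A g"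
    and "concircular_field A g V \<rho>"
    and "frenet_curve3 M A g I \<gamma>" and "arc_length_parametrized A g I \<gamma>"
    and "frenet_frame A g I \<gamma> T N B \<kappa> \<tau>"
    and "\<phi> = (\<lambda>s. \<tau> s / \<kappa> s)"
    and "concircular_curve A g V I \<gamma> N \<theta>"
    and "\<forall>s\<in>I. curve_deriv I \<phi> s \<noteq> 0"
  shows "\<forall>s\<in>I.
      \<theta> * curve_deriv I (\<lambda>t. \<kappa> t * (1 + (\<phi> t)\<^sup>2) / curve_deriv I \<phi> t) s
      + curve_deriv I (\<lambda>t. \<rho> (\<gamma> t) / curve_deriv I \<phi> t) s
      + \<theta> * \<kappa> s * \<phi> s = 0"
proof
  fix s assume s: "s \<in> I"
  have M: "Hausdorff_space M" "oriented_atlas M A" using assms(1) unfolding oriented_manifold_def by blast+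
  have \<gamma>: "smooth_curve M A I \<gamma>" using assms(5) unfolding frenet_curve3_def by blast
  have "\<gamma> s \<in> topspace M"
    using \<gamma> s continuous_map_image_subset_topspace unfolding smooth_curve_def by fastforce
  then obtain c where c: "c \<in> A" "\<gamma> s \<in> chart_dom c"
    using M(2) unfolding oriented_atlas_def by blast
  define J where "J = {s \<in> I. \<gamma> s \<in> chart_dom c}"
  have sJ: "s \<in> J" and JI: "\<And>t. t \<in> J \<Longrightarrow> t \<in> I" using s c by (auto simp: J_def)
  interpret curve_in_chart M c g I J \<gamma>
    unfolding J_def by (rule curve_in_chart_of_smooth_curve[OF M(2) c(1) assms(3) \<gamma>])
  let ?ip = "\<lambda>t. metric_inner g c (\<gamma> t)" and ?D = "cov_deriv_along g I \<gamma>"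
  have T: "T = velocity I \<gamma>" and smooth_NB: "smooth_on J (N c)" "smooth_on J (B c)"
    and \<kappa>_pos: "\<And>t. t \<in> J \<Longrightarrow> \<kappa> t > 0"
    using assms(7) c(1) JI unfolding frenet_frame_def field_along_def J_def by blast+
  have smooth_T: "smooth_on J (T c)" using smooth_velocity T by simp
  have frame: "?ip t (T c t) (T c t) = 1" "?ip t (N c t) (N c t) = 1" "?ip t (B c t) (B c t) = 1"
    "?ip t (T c t) (N c t) = 0" "?ip t (T c t) (B c t) = 0" "?ip t (N c t) (B c t) = 0"
    "?D T c t = \<kappa> t *\<^sub>R N c t" "?D N c t = - \<kappa> t *\<^sub>R T c t + \<tau> t *\<^sub>R B c t"
    "?D B c t = - \<tau> t *\<^sub>R N c t" if "t \<in> J" for t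
    using assms(7) c(1) JI[OF that] in_dom[OF that] unfolding frenet_frame_def Let_def by blast+
  have VN: "?ip t (V c (\<gamma> t)) (N c t) = \<theta>" if "t \<in> J" for t
    using assms(9) c(1) JI[OF that] in_dom[OF that] unfolding concircular_curve_def by blast

  \<comment> \<open>The frame equations give \<open>\<kappa>\<close> and \<open>\<tau>\<close> as inner products of smooth fields.\<close>
  have \<kappa>: "higher_differentiable_on 2 J \<kappa>"
    using metric_inner_cov_deriv_differentiable[where W = T and Z = N, OF smooth_T smooth_NB(1)]
    by (rule higher_differentiable_on_cong[THEN iffD1, rotated]) (simp add: frame metric_inner_algebra)
  have \<tau>: "higher_differentiable_on 2 J \<tau>"
    using metric_inner_cov_deriv_differentiable[where W = N and Z = B, OF smooth_NB]
  proof (rule higher_differentiable_on_cong[THEN iffD1, rotated])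
    fix t assume t: "t \<in> J"
    have "?ip t (B c t) (T c t) = 0"
      using frame(5)[OF t] metric_inner_commute[OF in_dom[OF t]] by simp
    then show "?ip t (B c t) (?D N c t) = \<tau> t"
      using t by (simp only: frame metric_inner_algebra)
  qed

  define W :: "'a curve_field" where "W c t = V c (\<gamma> t)" for c t
  have V: "smooth_on (coord_dom c) (local_rep c (V c))" and \<rho>: "smooth_on (coord_dom c) (local_rep c \<rho>)"
    using assms(4) c(1) unfolding concircular_field_def vector_field_def smooth_function_def by blast+
  have W_eq: "W c t = local_rep c (V c) (coord c (\<gamma> t))" if "t \<in> J" for t
    by (simp add: W_def local_rep_coord[OF chart in_dom[OF that]])
  have W: "smooth_on J (W c)"
    unfolding smooth_on_def
  proof
    show "higher_differentiable_on n J (W c)" for n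
      by (rule higher_differentiable_on_cong[THEN iffD2, OF W_eq coord_function_along_differentiable[OF V]])
  qed
  have r: "higher_differentiable_on 1 J (\<lambda>t. \<rho> (\<gamma> t))"
    using coord_function_along_differentiable[OF \<rho>]
    by (rule higher_differentiable_on_cong[THEN iffD1, rotated]) (rule local_rep_coord[OF chart in_dom])
  have DW: "?D W c t = \<rho> (\<gamma> t) *\<^sub>R T c t" if t: "t \<in> J" for t
  proof -
    have "curve_deriv I (W c) t = curve_deriv J (\<lambda>t. local_rep c (V c) (coord c (\<gamma> t))) t"
      unfolding curve_deriv_restrict[OF t] by (rule curve_deriv_cong[OF _ t]) (rule W_eq)
    also have "\<dots> = frechet_derivative (local_rep c (V c)) (at (coord c (\<gamma> t))) (T c t)"
      unfolding T by (rule curve_deriv_eq[OF unique_diff t coord_function_along_has_derivative[OF V t]])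
    finally show ?thesis
      using concircular_field_derivative[OF M assms(4) c(1) in_dom[OF t], of "T c t"]
      by (simp add: cov_deriv_along_def W_def T)
  qed
  \<comment> \<open>The three components of \<open>V\<close> in the Frenet frame: differentiating each of them yields the
    system solved in \<open>concircular_curve_ode\<close>.\<close>
  let ?v = "\<lambda>t. ?ip t (W c t) (T c t)" and ?b = "\<lambda>t. ?ip t (W c t) (B c t)"
  have WN: "?ip t (W c t) (N c t) = \<theta>" if "t \<in> J" for t using VN[OF that] by (simp add: W_def)
  have v: "(?v has_real_derivative \<rho> (\<gamma> t) + \<theta> * \<kappa> t) (at t within J)" if t: "t \<in> J" for t
    using metric_inner_along_has_derivative[where W = W and Z = T, OF W smooth_T t]
    by (simp add: DW frame metric_inner_algebra WN t mult.commute)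
  have b: "(?b has_real_derivative - \<theta> * \<tau> t) (at t within J)" if t: "t \<in> J" for t
    using metric_inner_along_has_derivative[where W = W and Z = B, OF W smooth_NB(2) t]
    by (simp only: DW frame metric_inner_algebra WN t) (simp add: mult.commute)
  have vb: "\<kappa> t * ?v t = \<tau> t * ?b t" if t: "t \<in> J" for t
  proof -
    have "((\<lambda>t. ?ip t (W c t) (N c t)) has_real_derivative - \<kappa> t * ?v t + \<tau> t * ?b t) (at t within J)"
      using metric_inner_along_has_derivative[where W = W and Z = N, OF W smooth_NB(1) t]
      by (simp only: DW frame metric_inner_algebra t) simp
    moreover have "((\<lambda>t. ?ip t (W c t) (N c t)) has_real_derivative 0) (at t within J)"
      by (rule has_field_derivative_transform_within[OF DERIV_const zero_less_one t]) (simp add: WN)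
    ultimately have "- \<kappa> t * ?v t + \<tau> t * ?b t = 0" by (rule DERIV_unique_within[OF unique_diff t])
    then show ?thesis by simp
  qed

  have \<phi>': "curve_deriv I \<phi> t = curve_deriv J \<phi> t" if "t \<in> J" for t by (rule curve_deriv_restrict[OF that])
  have "\<theta> * curve_deriv J (\<lambda>t. \<kappa> t * (1 + (\<phi> t)\<^sup>2) / curve_deriv J \<phi> t) s
      + curve_deriv J (\<lambda>t. \<rho> (\<gamma> t) / curve_deriv J \<phi> t) s + \<theta> * \<kappa> s * \<phi> s = 0"
    by (rule concircular_curve_ode[OF unique_diff \<kappa> _ \<tau> r assms(8) _ v b vb sJ])
       (use \<kappa>_pos JI assms(10) \<phi>' in force)+
  moreover have "curve_deriv I (\<lambda>t. h t / curve_deriv I \<phi> t) s = curve_deriv J (\<lambda>t. h t / curve_deriv J \<phi> t) s" for h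
    unfolding curve_deriv_restrict[OF sJ] by (rule curve_deriv_cong[OF _ sJ]) (simp add: \<phi>')
  ultimately show "\<theta> * curve_deriv I (\<lambda>t. \<kappa> t * (1 + (\<phi> t)\<^sup>2) / curve_deriv I \<phi> t) s
      + curve_deriv I (\<lambda>t. \<rho> (\<gamma> t) / curve_deriv I \<phi> t) s + \<theta> * \<kappa> s * \<phi> s = 0"
    by simp
qed

end
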